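(* Let $G$ be a countable monoid and let $A$ be an admissible Artinian group structure. Let $\Sigma \subset A^G$ be an admissible group subshift. Suppose that $\Gamma \subset \mathrm{End}_{G\text{-grp}}(\Sigma)$ is a finitely generated abelian submonoid (under composition of maps). Then the valuation action of $\Gamma$ on $\Sigma$ has the shadowing property.
   Context: Admissible Artinian group structure: a group $A$ together with, for every integer $n\ge 1$, a collection $\mathcal{H}_n$ of subgroups of $A^n$ (called the admissible subgroups of $A^n$) such that: (1) $\{1_A\},A\in\mathcal{H}_1$; (2) for all $m\ge n\ge 1$ and every projection $\pi:A^m\to A^n$ induced by an injection $\{1,\dots,n\}\to\{1,\dots,m\}$, one has $\pi(H_m)\in\mathcal{H}_n$ and $\pi^{-1}(H_n)\in\mathcal{H}_m$ for all $H_m\in\mathcal{H}_m$, $H_n\in\mathcal{H}_n$; (3) $H\cap K\in\mathcal{H}_n$ for all $n\ge1$ and $H,K\in\mathcal{H}_n$; (4) for every $n\ge 1$, every descending sequence of elements of $\mathcal{H}_n$ eventually stabilizes. For a finite set $E$, admissible subgroups of $A^E$ are defined via any bijection $\{1,\dots,|E|\}\to E$. A group homomorphism $\varphi:A^m\to A^n$ is admissible if its graph $\{(x,\varphi(x)):x\in A^m\}$ is an admissible subgroup of $A^{m+n}$ (similarly for finite index sets). The right shift action of $G$ on $A^G$ is $(g\star x)(h)=x(hg)$. A subshift is a subset $\Sigma\subset A^G$ with $g\star x\in\Sigma$ for all $g\in G,x\in\Sigma$. For $E\subset G$, $\Sigma_E=\{x|_E:x\in\Sigma\}$. A subshift $\Sigma\subset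 A^G$ is an admissible group subshift if it is closed in the prodiscrete topology (product topology with $A$ discrete) and $\Sigma_E$ is an admissible subgroup of $A^E$ for every finite $E\subset G$. A map $\tau:A^G\to A^G$ is a cellular automaton if there are a finite set $M\subset G$ (memory set) and a map $\mu:A^M\to A$ (local defining map) with $\tau(x)(g)=\mu((g\star x)|_M)$ for all $x\in A^G,g\in G$. $\mathrm{End}_{G\text{-grp}}(\Sigma)$ is the set of maps $\Sigma\to\Sigma$ that extend to a cellular automaton $A^G\to A^G$ admitting a memory set $M$ whose associated local defining map $\mu:A^M\to A$ is an admissible homomorphism. The valuation action $T$ of $\Gamma$ on $\Sigma$ is $T(\tau,x)=\tau(x)$. Standard Hamming metrics: let $(E_n)_{n\ge 0}$ be finite subsets of $G$ with $E_0=\varnothing$, $E_n\subset E_{n+1}$ and $G=\bigcup_n E_n$. The associated standard Hamming metric on $A^G$ is $d(x,y)=2^{-n}$ with $n=\sup\{k\in\mathbb{N}: x|_{E_k}=y|_{E_k}\}$ (with $2^{-\infty}=0$). Shadowing: let $T$ be an action of a finitely generated monoid $\Gamma$ on a set $X$, $S$ a finite generating set of $\Gamma$, $d$ a metric on $X$. For $\delta>0$, a family $(x_\tau)_{\tau\in\Gamma}$ in $X$ is an $(S,d,\delta)$-pseudo-orbit of $T$ if $d(T(\sigma,x_\tau),x_{\sigma\tau})<\delta$ for all $\sigma\in S$, $\tau\in\Gamma$. $T$ has the $(S,d)$-shadowing property if for every $\varepsilon>0$ there is $\delta>0$ such that for every $(S,d,\delta)$-pseudo-orbit $(x_\tau)_{\tau\in\Gamma}$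 there is $x\in X$ with $d(T(\tau,x),x_\tau)<\varepsilon$ for all $\tau\in\Gamma$. An action of a finitely generated monoid $\Gamma$ on a subshift $\Sigma\subset A^G$ has the shadowing property if it has the $(S,d|_\Sigma)$-shadowing property for every finite generating set $S$ of $\Gamma$ and every standard Hamming metric $d$ on $A^G$. *)

theory Defs
  imports "HOL-Analysis.Function_Topology" "HOL-Algebra.Product_Groups" "HOL-Library.Extended_Nat"
begin

text \<open>Elements of \<open>A^I\<close> are extensional functions, so that \<open>x|\<^sub>E\<close> is \<^term>\<open>restrict x E\<close>.
  For finite \<open>n\<close>, \<open>A^n\<close> is \<open>A^{1..n}\<close>; in particular \<open>A\<close> is identified with \<open>A^{1..1}\<close>.\<close>

abbreviation power_group :: "('a, 'c) monoid_scheme \<Rightarrow> 'i set \<Rightarrow> ('i \<Rightarrow> 'a) monoid" where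
  "power_group A I \<equiv> product_group I (\<lambda>_. A)"

definition reindex :: "('i \<Rightarrow> 'j) \<Rightarrow> 'i set \<Rightarrow> ('j \<Rightarrow> 'a) \<Rightarrow> ('i \<Rightarrow> 'a)" where
  "reindex f I x = (\<lambda>i\<in>I. x (f i))"


subsection \<open>Admissible Artinian group structures\<close>

text \<open>Only the values \<open>\<H> n\<close> with \<open>n \<ge> 1\<close> are meaningful.\<close>

locale admissible_artinian_group_structure = group A
  for A :: "('a, 'c) monoid_scheme" (structure) and \<H> :: "nat \<Rightarrow> (nat \<Rightarrow> 'a) set set" +
  assumes admissible_subgroup:
      "\<And>n K. n \<ge> 1 \<Longrightarrow> K \<in> \<H> n \<Longrightarrow> subgroup K (power_group A {1..n})"
    and trivial_admissible: "{\<one>\<^bsub>power_group A {1..1}\<^esub>} \<in> \<H> 1"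
    and full_admissible: "carrier (power_group A {1..1}) \<in> \<H> 1"
    and image_admissible:
      "\<And>m n f K. n \<ge> 1 \<Longrightarrow> m \<ge> n \<Longrightarrow> f \<in> {1..n} \<rightarrow> {1..m} \<Longrightarrow> inj_on f {1..n} \<Longrightarrow> K \<in> \<H> m
        \<Longrightarrow> reindex f {1..n} ` K \<in> \<H> n"
    and vimage_admissible:
      "\<And>m n f K. n \<ge> 1 \<Longrightarrow> m \<ge> n \<Longrightarrow> f \<in> {1..n} \<rightarrow> {1..m} \<Longrightarrow> inj_on f {1..n} \<Longrightarrow> K \<in> \<H> n
        \<Longrightarrow> {x \<in> carrier (power_group A {1..m}). reindex f {1..n} x \<in> K} \<in> \<H> m"
    and Int_admissible: "\<And>n K L. n \<ge> 1 \<Longrightarrow> K \<in> \<H> n \<Longrightarrow> L \<in> \<H> n \<Longrightarrow> K \<inter> L \<in> \<H> n"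
    and descending_chain:
      "\<And>n K. n \<ge> 1 \<Longrightarrow> (\<And>i::nat. K i \<in> \<H> n) \<Longrightarrow> (\<And>i. K (Suc i) \<subseteq> K i)
        \<Longrightarrow> \<exists>N. \<forall>i\<ge>N. K i = K N"

text \<open>Admissible subgroups of \<open>A^E\<close>, \<open>E\<close> finite. The structure says nothing about exponent \<open>0\<close>; the only
  subgroup of the trivial group \<open>A^{}\<close> is declared admissible.\<close>

definition admissible_subgroups ::
  "('a, 'c) monoid_scheme \<Rightarrow> (nat \<Rightarrow> (nat \<Rightarrow> 'a) set set) \<Rightarrow> 'e set \<Rightarrow> ('e \<Rightarrow> 'a) set set" where
  "admissible_subgroups A \<H> E =
    (if E = {} then {carrier (power_group A {})}
     else {K. K \<subseteq> carrier (power_group A E) \<and>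
              (\<exists>b. bij_betw b {1..card E} E \<and> reindex b {1..card E} ` K \<in> \<H> (card E))})"

lemma (in admissible_artinian_group_structure) admissible_subgroups_any_bij:
  fixes E :: "'e set"
  assumes "finite E" "E \<noteq> {}" "bij_betw b {1..card E} E"
  shows "K \<in> admissible_subgroups A \<H> E \<longleftrightarrow>
    K \<subseteq> carrier (power_group A E) \<and> reindex b {1..card E} ` K \<in> \<H> (card E)"
proof -
  let ?I = "{1..card E}"
  have n: "card E \<ge> 1"
    using assms(1,2) by (simp add: Suc_leI card_gt_0_iff)
  have "reindex b ?I ` K \<in> \<H> (card E)"
    if c: "bij_betw c ?I E" and K: "reindex c ?I ` K \<in> \<H> (card E)" for c
  proof -
    define f where "f = inv_into ?I c \<circ> b"
    have f: "bij_betw f ?I ?I"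
      unfolding f_def using assms(3) bij_betw_inv_into[OF c] by (rule bij_betw_trans)
    have cf: "c (f i) = b i" if "i \<in> ?I" for i
      using that assms(3) c by (auto simp: f_def bij_betw_def intro!: f_inv_into_f)
    have fI: "f i \<in> ?I" if "i \<in> ?I" for i
      using f that by (auto simp: bij_betw_def)
    have "reindex f ?I (reindex c ?I x) = reindex b ?I x" for x :: "'e \<Rightarrow> 'a"
      using cf fI unfolding reindex_def by (intro ext) (simp add: restrict_def)
    then have "reindex b ?I ` K = reindex f ?I ` (reindex c ?I ` K)"
      by (simp add: image_image)
    also have "\<dots> \<in> \<H> (card E)"
      using n f K by (intro image_admissible) (auto simp: bij_betw_def)
    finally show ?thesis .
  qed
  then show ?thesis
    using assms by (auto simp: admissible_subgroups_def)
qed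

text \<open>The graph of \<open>\<phi> : A^E \<rightarrow> A^F\<close> lives in \<open>A^E \<times> A^F\<close>, identified with \<open>A^(E <+> F)\<close>.\<close>

definition admissible_hom ::
  "('a, 'c) monoid_scheme \<Rightarrow> (nat \<Rightarrow> (nat \<Rightarrow> 'a) set set) \<Rightarrow> 'e set \<Rightarrow> 'f set
    \<Rightarrow> (('e \<Rightarrow> 'a) \<Rightarrow> ('f \<Rightarrow> 'a)) \<Rightarrow> bool" where
  "admissible_hom A \<H> E F \<phi> \<longleftrightarrow>
    \<phi> \<in> hom (power_group A E) (power_group A F) \<and>
    (\<lambda>x. restrict (case_sum x (\<phi> x)) (E <+> F)) ` carrier (power_group A E)
      \<in> admissible_subgroups A \<H> (E <+> F)"


subsection \<open>Subshifts and cellular automata\<close>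

abbreviation configurations ::
  "('g, 'b) monoid_scheme \<Rightarrow> ('a, 'c) monoid_scheme \<Rightarrow> ('g \<Rightarrow> 'a) set" where
  "configurations G A \<equiv> carrier G \<rightarrow>\<^sub>E carrier A"

definition shift :: "('g, 'b) monoid_scheme \<Rightarrow> 'g \<Rightarrow> ('g \<Rightarrow> 'a) \<Rightarrow> ('g \<Rightarrow> 'a)" where
  "shift G g x = (\<lambda>h\<in>carrier G. x (h \<otimes>\<^bsub>G\<^esub> g))"

definition subshift ::
  "('g, 'b) monoid_scheme \<Rightarrow> ('a, 'c) monoid_scheme \<Rightarrow> ('g \<Rightarrow> 'a) set \<Rightarrow> bool" where
  "subshift G A \<Sigma> \<longleftrightarrow>
    \<Sigma> \<subseteq> configurations G A \<and> (\<forall>g\<in>carrier G. \<forall>x\<in>\<Sigma>. shift G g x \<in> \<Sigma>)"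

definition admissible_group_subshift ::
  "('g, 'b) monoid_scheme \<Rightarrow> ('a, 'c) monoid_scheme \<Rightarrow> (nat \<Rightarrow> (nat \<Rightarrow> 'a) set set)
    \<Rightarrow> ('g \<Rightarrow> 'a) set \<Rightarrow> bool" where
  "admissible_group_subshift G A \<H> \<Sigma> \<longleftrightarrow>
    subshift G A \<Sigma> \<and>
    closedin (product_topology (\<lambda>_. discrete_topology (carrier A)) (carrier G)) \<Sigma> \<and>
    (\<forall>E. finite E \<and> E \<subseteq> carrier G \<longrightarrow> (\<lambda>x. restrict x E) ` \<Sigma> \<in> admissible_subgroups A \<H> E)"

text \<open>\<open>\<tau>\<close> is a cellular automaton with memory set \<open>M\<close> and local defining map \<open>\<mu>\<close>.\<close>

definition cellular_automaton_with ::
  "('g, 'b) monoid_scheme \<Rightarrow> ('a, 'c) monoid_scheme \<Rightarrow> 'g set \<Rightarrow> (('g \<Rightarrow> 'a) \<Rightarrow> 'a)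
    \<Rightarrow> (('g \<Rightarrow> 'a) \<Rightarrow> ('g \<Rightarrow> 'a)) \<Rightarrow> bool" where
  "cellular_automaton_with G A M \<mu> \<tau> \<longleftrightarrow>
    finite M \<and> M \<subseteq> carrier G \<and> \<mu> \<in> (M \<rightarrow>\<^sub>E carrier A) \<rightarrow> carrier A \<and>
    \<tau> \<in> configurations G A \<rightarrow> configurations G A \<and>
    (\<forall>x\<in>configurations G A. \<forall>g\<in>carrier G. \<tau> x g = \<mu> (restrict (shift G g x) M))"

text \<open>Maps \<open>\<Sigma> \<rightarrow> \<Sigma>\<close> are extensional, so that equality in the structure is equality of maps on \<open>\<Sigma>\<close>.
  The local defining map \<open>\<mu>\<close> is viewed as a map into \<open>A^{1..1}\<close>. The identity of \<open>\<Sigma>\<close> need not lie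
  in the carrier (the diagonal of \<open>A^2\<close> is not required to be admissible), so this is a monoid
  only when it does.\<close>

definition End_grp ::
  "('g, 'b) monoid_scheme \<Rightarrow> ('a, 'c) monoid_scheme \<Rightarrow> (nat \<Rightarrow> (nat \<Rightarrow> 'a) set set)
    \<Rightarrow> ('g \<Rightarrow> 'a) set \<Rightarrow> (('g \<Rightarrow> 'a) \<Rightarrow> ('g \<Rightarrow> 'a)) monoid" where
  "End_grp G A \<H> \<Sigma> =
    \<lparr>carrier = {\<tau> \<in> \<Sigma> \<rightarrow>\<^sub>E \<Sigma>. \<exists>\<tau>' M \<mu>. cellular_automaton_with G A M \<mu> \<tau>' \<and>
        admissible_hom A \<H> M {1..1::nat} (\<lambda>x. \<lambda>i\<in>{1..1}. \<mu> x) \<and> (\<forall>x\<in>\<Sigma>. \<tau> x = \<tau>' x)},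
     mult = compose \<Sigma>,
     one = (\<lambda>x\<in>\<Sigma>. x)\<rparr>"

definition valuation_action :: "('x \<Rightarrow> 'x) \<Rightarrow> 'x \<Rightarrow> 'x" where
  "valuation_action \<tau> x = \<tau> x"


subsection \<open>Shadowing\<close>

definition generates_monoid :: "('m, 'b) monoid_scheme \<Rightarrow> 'm set \<Rightarrow> bool" where
  "generates_monoid \<Gamma> S \<longleftrightarrow>
    S \<subseteq> carrier \<Gamma> \<and> (\<forall>N. submonoid N \<Gamma> \<and> S \<subseteq> N \<longrightarrow> N = carrier \<Gamma>)"

definition finitely_generated_monoid :: "('m, 'b) monoid_scheme \<Rightarrow> bool" where
  "finitely_generated_monoid \<Gamma> \<longleftrightarrow> (\<exists>S. finite S \<and> generates_monoid \<Gamma> S)"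

definition pseudo_orbit ::
  "('m, 'b) monoid_scheme \<Rightarrow> 'x set \<Rightarrow> ('m \<Rightarrow> 'x \<Rightarrow> 'x) \<Rightarrow> 'm set \<Rightarrow> ('x \<Rightarrow> 'x \<Rightarrow> real) \<Rightarrow> real
    \<Rightarrow> ('m \<Rightarrow> 'x) \<Rightarrow> bool" where
  "pseudo_orbit \<Gamma> X T S d \<delta> x \<longleftrightarrow>
    (\<forall>\<tau>\<in>carrier \<Gamma>. x \<tau> \<in> X) \<and>
    (\<forall>\<sigma>\<in>S. \<forall>\<tau>\<in>carrier \<Gamma>. d (T \<sigma> (x \<tau>)) (x (\<sigma> \<otimes>\<^bsub>\<Gamma>\<^esub> \<tau>)) < \<delta>)"

definition shadowing_wrt ::
  "('m, 'b) monoid_scheme \<Rightarrow> 'x set \<Rightarrow> ('m \<Rightarrow> 'x \<Rightarrow> 'x) \<Rightarrow> 'm set \<Rightarrow> ('x \<Rightarrow> 'x \<Rightarrow> real) \<Rightarrow> bool" where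
  "shadowing_wrt \<Gamma> X T S d \<longleftrightarrow>
    (\<forall>\<epsilon>>0. \<exists>\<delta>>0. \<forall>x. pseudo_orbit \<Gamma> X T S d \<delta> x \<longrightarrow>
      (\<exists>y\<in>X. \<forall>\<tau>\<in>carrier \<Gamma>. d (T \<tau> y) (x \<tau>) < \<epsilon>))"

definition standard_hamming_dist :: "(nat \<Rightarrow> 'g set) \<Rightarrow> ('g \<Rightarrow> 'a) \<Rightarrow> ('g \<Rightarrow> 'a) \<Rightarrow> real" where
  "standard_hamming_dist E x y =
    (case (SUP k \<in> {k. restrict x (E k) = restrict y (E k)}. enat k) of
       enat n \<Rightarrow> (1 / 2) ^ n
     | \<infinity> \<Rightarrow> 0)"

definition standard_hamming_metric ::
  "('g, 'b) monoid_scheme \<Rightarrow> (('g \<Rightarrow> 'a) \<Rightarrow> ('g \<Rightarrow> 'a) \<Rightarrow> real) \<Rightarrow> bool" where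
  "standard_hamming_metric G d \<longleftrightarrow>
    (\<exists>E. (\<forall>n. finite (E n)) \<and> E 0 = {} \<and> (\<forall>n. E n \<subseteq> E (Suc n)) \<and> (\<Union>n. E n) = carrier G \<and>
      d = standard_hamming_dist E)"

definition has_shadowing_property ::
  "('g, 'b) monoid_scheme \<Rightarrow> ('m, 'c) monoid_scheme \<Rightarrow> ('g \<Rightarrow> 'a) set
    \<Rightarrow> ('m \<Rightarrow> ('g \<Rightarrow> 'a) \<Rightarrow> ('g \<Rightarrow> 'a)) \<Rightarrow> bool" where
  "has_shadowing_property G \<Gamma> \<Sigma> T \<longleftrightarrow>
    (\<forall>S d. finite S \<and> generates_monoid \<Gamma> S \<and> standard_hamming_metric G d
      \<longrightarrow> shadowing_wrt \<Gamma> \<Sigma> T S d)"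

end

(* The elements of Gamma are values a(n) of a multiplicative map on the set Q of positive integers with
   prime factors in a finite set, so that Q is totally ordered compatibly with multiplication.
   For a finite window E let L(n) be the set of restrictions to E of a(n) x, where x ranges over the
   points of Sigma with a(m) x = 1 on E for all m < n in Q. The L(n) are admissible, and L(n) is
   contained in L(m) whenever m divides n. By Dickson's lemma and the descending chain condition there is
   a finite set M in Q such that every n in Q has a divisor m in M with L(m) = L(n).
   Given a pseudo-orbit z, exact on a window large enough for all words up to the bound of M, a point
   x following z on E at all k < n is corrected at n = m e: the quotient of z(a(e)) by a(e) x is trivial
   on E under a(k) for k < m, so its image under a(m) lies in L(m) = L(n), and this yields a correction
   that does not disturb the indices below n. The descending chain condition also supplies the
   compactness needed to follow z at all n at once. *)
theory Submission
  imports Defs "HOL-Computational_Algebra.Primes" "HOL-Algebra.FiniteProduct"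
begin

section \<open>Admissible subgroups over finite index sets\<close>

text \<open>The axioms offer coordinate projections, their preimages, intersections and descending
  chains; images and kernels of endomorphisms are not among them. Every subgroup fed to the chain
  condition is therefore built as a projection of a subgroup of a larger finite power, in which
  graphs of local maps are imposed on auxiliary coordinates. This requires an admissible relation
  expressing equality of coordinates, which is extracted from the identity in \<Gamma>. Encoding
  exponent vectors by integers leaves only finitely many indices below each n, so the constraints
  present at each stage of the induction are finite in number. The finiteness of M matters because
  delta must be fixed before the pseudo-orbit is known: exactness is transported only along a(k)
  with k at most the bound of M, however large n becomes. A may be nonabelian, so sides matter:
  quotients have the form z x^-1, and corrections multiply from the left. For nontrivial prescribed
  values, nonempty solution sets are cosets, and the chain condition reaches them through their
  kernels.\<close>

lemma carrier_power_group: "carrier (power_group A I) = I \<rightarrow>\<^sub>E carrier A"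
  by simp

lemma reindex_reindex:
  assumes "f \<in> I \<rightarrow> J"
  shows "reindex f I (reindex g J x) = reindex (g \<circ> f) I x"
  using assms by (auto simp: reindex_def fun_eq_iff restrict_def)

lemma reindex_cong: "(\<And>i. i \<in> I \<Longrightarrow> f i = g i) \<Longrightarrow> reindex f I x = reindex g I x"
  by (auto simp: reindex_def fun_eq_iff restrict_def)

lemma reindex_ident: "x \<in> I \<rightarrow>\<^sub>E B \<Longrightarrow> (\<And>i. i \<in> I \<Longrightarrow> f i = i) \<Longrightarrow> reindex f I x = x"
  by (auto simp: reindex_def fun_eq_iff restrict_def PiE_def extensional_def)

lemma reindex_PiE: "f \<in> I \<rightarrow> J \<Longrightarrow> x \<in> J \<rightarrow>\<^sub>E B \<Longrightarrow> reindex f I x \<in> I \<rightarrow>\<^sub>E B"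
  by (auto simp: reindex_def)

lemma inj_on_reindex:
  assumes "f ` I = J"
  shows "inj_on (reindex f I) (J \<rightarrow>\<^sub>E B)"
proof (rule inj_onI)
  fix x y assume x: "x \<in> J \<rightarrow>\<^sub>E B" and y: "y \<in> J \<rightarrow>\<^sub>E B" and eq: "reindex f I x = reindex f I y"
  show "x = y"
  proof (rule PiE_ext[OF x y])
    fix j assume "j \<in> J"
    then obtain i where "i \<in> I" "j = f i" using assms by auto
    then show "x j = y j" using fun_cong[OF eq, of i] by (simp add: reindex_def)
  qed
qed

context admissible_artinian_group_structure
begin

lemma obtain_bij:
  fixes E :: "'e set"
  assumes "finite E"
  obtains b where "bij_betw b {1..card E} E"
  using ex_bij_betw_nat_finite_1[OF assms] by blast

lemma admissible_subset:
  "K \<in> admissible_subgroups A \<H> E \<Longrightarrow> K \<subseteq> E \<rightarrow>\<^sub>E carrier A"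
  by (auto simp: admissible_subgroups_def split: if_splits)

lemma admissible_empty_iff: "K \<in> admissible_subgroups A \<H> {} \<longleftrightarrow> K = {\<lambda>_. undefined}"
  by (simp add: admissible_subgroups_def)

lemma admissible_atLeastAtMost_iff:
  assumes "n \<ge> 1"
  shows "K \<in> admissible_subgroups A \<H> {1..n} \<longleftrightarrow> K \<in> \<H> n"
proof -
  have id: "reindex id {1..n} ` L = L" if "L \<subseteq> {1..n} \<rightarrow>\<^sub>E carrier A" for L
  proof -
    have "reindex id {1..n} x = x" if "x \<in> L" for x
      using that \<open>L \<subseteq> _\<close> by (intro reindex_ident) auto
    then show ?thesis by simp
  qed
  have sub: "K \<in> \<H> n \<Longrightarrow> K \<subseteq> {1..n} \<rightarrow>\<^sub>E carrier A"
    using subgroup.subset[OF admissible_subgroup[OF assms]] by simp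
  have "K \<in> admissible_subgroups A \<H> {1..n} \<longleftrightarrow>
      K \<subseteq> carrier (power_group A {1..n}) \<and> reindex id {1..n} ` K \<in> \<H> n"
    using admissible_subgroups_any_bij[of "{1..n}" id K] assms by simp
  then show ?thesis using id sub by auto
qed

lemma admissible_transfer:
  assumes "finite E" "E \<noteq> {}" "bij_betw b {1..card E} E" "K \<subseteq> E \<rightarrow>\<^sub>E carrier A"
  shows "K \<in> admissible_subgroups A \<H> E \<longleftrightarrow> reindex b {1..card E} ` K \<in> \<H> (card E)"
  using admissible_subgroups_any_bij[OF assms(1-3)] assms(4) by simp

lemma admissible_nonempty:
  assumes "finite E" "K \<in> admissible_subgroups A \<H> E"
  shows "K \<noteq> {}"
proof (cases "E = {}")
  case True
  then show ?thesis using assms by (simp add: admissible_empty_iff)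
next
  case False
  obtain b where b: "bij_betw b {1..card E} E" using obtain_bij[OF assms(1)] .
  have n: "card E \<ge> 1" using assms(1) False by (simp add: Suc_leI card_gt_0_iff)
  have "reindex b {1..card E} ` K \<in> \<H> (card E)"
    using admissible_subgroups_any_bij[OF assms(1) False b] assms(2) by blast
  then show ?thesis
    using subgroup.one_closed[OF admissible_subgroup[OF n]] by blast
qed

text \<open>The axioms concern injections between initial segments \<open>{1..n}\<close> only.
  Conjugating \<open>f\<close> by enumerations of \<open>E\<close> and \<open>F\<close> produces
  such an injection \<open>h\<close>, so that the axioms can act on arbitrary finite index
  sets.\<close>

lemma obtain_coordinates:
  fixes f :: "'f \<Rightarrow> 'e"
  assumes E: "finite E" and f: "f \<in> F \<rightarrow> E" "inj_on f F"
  obtains b c h where "bij_betw b {1..card E} E" "bij_betw c {1..card F} F"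
    "h \<in> {1..card F} \<rightarrow> {1..card E}" "inj_on h {1..card F}"
    "\<forall>x::'e \<Rightarrow> 'a. reindex c {1..card F} (reindex f F x) = reindex h {1..card F} (reindex b {1..card E} x)"
proof -
  have F: "finite F" using finite_imageD[OF finite_subset[OF _ E] f(2)] f(1) by blast
  obtain b where b: "bij_betw b {1..card E} E" using obtain_bij[OF E] .
  obtain c where c: "bij_betw c {1..card F} F" using obtain_bij[OF F] .
  let ?I = "{1..card F}" and ?J = "{1..card E}"
  define h where "h = inv_into ?J b \<circ> f \<circ> c"
  have cF: "c i \<in> F" if "i \<in> ?I" for i using that c by (auto simp: bij_betw_def)
  have fc: "f (c i) \<in> b ` ?J" if "i \<in> ?I" for i
    using cF[OF that] f(1) b by (auto simp: bij_betw_def)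
  have bh: "b (h i) = f (c i)" if "i \<in> ?I" for i
    using f_inv_into_f[OF fc[OF that]] by (simp add: h_def)
  have hJ: "h \<in> ?I \<rightarrow> ?J"
    using inv_into_into[OF fc] by (auto simp: h_def)
  have hinj: "inj_on h ?I"
  proof (rule inj_onI)
    fix i j assume ij: "i \<in> ?I" "j \<in> ?I" "h i = h j"
    then have "f (c i) = f (c j)" using bh[of i] bh[of j] by simp
    then have "c i = c j" using cF ij f(2) by (auto dest: inj_onD)
    then show "i = j" using ij c by (auto simp: bij_betw_def dest: inj_onD)
  qed
  have eq: "reindex c ?I (reindex f F x) = reindex h ?I (reindex b ?J x)" for x :: "'e \<Rightarrow> 'a"
  proof -
    have "reindex c ?I (reindex f F x) = reindex (f \<circ> c) ?I x"
      using cF by (intro reindex_reindex) auto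
    also have "\<dots> = reindex (b \<circ> h) ?I x" using bh by (intro reindex_cong) auto
    also have "\<dots> = reindex h ?I (reindex b ?J x)" using hJ by (simp add: reindex_reindex)
    finally show ?thesis .
  qed
  show thesis by (rule that[OF b c hJ hinj]) (intro allI eq)
qed

lemma admissible_image:
  fixes f :: "'f \<Rightarrow> 'e"
  assumes E: "finite E" and f: "f \<in> F \<rightarrow> E" "inj_on f F"
    and K: "K \<in> admissible_subgroups A \<H> E"
  shows "reindex f F ` K \<in> admissible_subgroups A \<H> F"
proof (cases "F = {}")
  case True
  have "reindex f F ` K = {\<lambda>_. undefined}"
    using admissible_nonempty[OF E K] True by (auto simp: reindex_def restrict_def)
  then show ?thesis using admissible_empty_iff unfolding True by blast
next
  case False
  have F: "finite F" using finite_imageD[OF finite_subset[OF _ E] f(2)] f(1) by blast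
  have E0: "E \<noteq> {}" using False f by auto
  obtain b c h where b: "bij_betw b {1..card E} E" and c: "bij_betw c {1..card F} F"
    and h: "h \<in> {1..card F} \<rightarrow> {1..card E}" "inj_on h {1..card F}"
    and eq: "\<forall>x::'e \<Rightarrow> 'a. reindex c {1..card F} (reindex f F x) = reindex h {1..card F} (reindex b {1..card E} x)"
    using obtain_coordinates[OF E f] .
  let ?I = "{1..card F}" and ?J = "{1..card E}"
  have le: "card F \<le> card E" using card_inj_on_le[OF f(2) _ E] f(1) by blast
  have n: "card F \<ge> 1" using F False by (simp add: Suc_leI card_gt_0_iff)
  have "reindex b ?J ` K \<in> \<H> (card E)"
    using admissible_subgroups_any_bij[OF E E0 b] K by blast
  then have "reindex h ?I ` (reindex b ?J ` K) \<in> \<H> (card F)"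
    using image_admissible[OF n le h] by blast
  then have "reindex c ?I ` (reindex f F ` K) \<in> \<H> (card F)"
    by (simp only: image_image spec[OF eq])
  moreover have "reindex f F ` K \<subseteq> F \<rightarrow>\<^sub>E carrier A"
    by (rule image_subsetI) (rule reindex_PiE[OF f(1) subsetD[OF admissible_subset[OF K]]])
  ultimately show ?thesis using admissible_transfer[OF F False c] by blast
qed

lemma admissible_trivial:
  "{x \<in> {i} \<rightarrow>\<^sub>E carrier A. x i = \<one>} \<in> admissible_subgroups A \<H> {i}"
proof -
  have "{\<one>\<^bsub>power_group A {1..1}\<^esub>} \<in> admissible_subgroups A \<H> {1..1::nat}"
    using trivial_admissible admissible_atLeastAtMost_iff by blast
  then have "reindex (\<lambda>_. 1) {i} ` {\<one>\<^bsub>power_group A {1..1::nat}\<^esub>} \<in> admissible_subgroups A \<H> {i}"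
    by (rule admissible_image[rotated 3]) auto
  moreover have "reindex (\<lambda>_. 1) {i} ` {\<one>\<^bsub>power_group A {1..1::nat}\<^esub>} = {x \<in> {i} \<rightarrow>\<^sub>E carrier A. x i = \<one>}"
    by (auto simp: reindex_def fun_eq_iff PiE_def extensional_def)
  ultimately show ?thesis by simp
qed

lemma admissible_full_singleton: "{i} \<rightarrow>\<^sub>E carrier A \<in> admissible_subgroups A \<H> {i}"
proof -
  have "carrier (power_group A {1..1}) \<in> admissible_subgroups A \<H> {1..1::nat}"
    using full_admissible admissible_atLeastAtMost_iff by blast
  then have "reindex (\<lambda>_. 1) {i} ` carrier (power_group A {1..1::nat}) \<in> admissible_subgroups A \<H> {i}"
    by (rule admissible_image[rotated 3]) auto
  moreover have "reindex (\<lambda>_. 1) {i} ` carrier (power_group A {1..1::nat}) = {i} \<rightarrow>\<^sub>E carrier A"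
  proof (intro equalityI subsetI)
    fix x assume x: "x \<in> {i} \<rightarrow>\<^sub>E carrier A"
    then have "x = reindex (\<lambda>_. 1) {i} (\<lambda>k\<in>{1..1::nat}. x i)"
      by (auto simp: reindex_def fun_eq_iff PiE_def extensional_def)
    moreover have "(\<lambda>k\<in>{1..1::nat}. x i) \<in> carrier (power_group A {1..1::nat})" using x by auto
    ultimately show "x \<in> reindex (\<lambda>_. 1) {i} ` carrier (power_group A {1..1::nat})" by blast
  next
    fix x assume "x \<in> reindex (\<lambda>_. 1) {i} ` carrier (power_group A {1..1::nat})"
    then obtain y where "y \<in> {1..1::nat} \<rightarrow>\<^sub>E carrier A" "x = reindex (\<lambda>_. 1) {i} y"
      by (auto simp only: carrier_power_group)
    then show "x \<in> {i} \<rightarrow>\<^sub>E carrier A" using reindex_PiE[of "\<lambda>_. 1" "{i}" "{1..1::nat}" y] by simp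
  qed
  ultimately show ?thesis by simp
qed

text \<open>The case \<open>F = {}\<close> is postponed: the preimage is then the whole power, and
  \<open>admissible_full\<close> is itself derived from this lemma.\<close>

lemma admissible_vimage_nonempty:
  fixes f :: "'f \<Rightarrow> 'e"
  assumes E: "finite E" and f: "f \<in> F \<rightarrow> E" "inj_on f F" and F0: "F \<noteq> {}"
    and K: "K \<in> admissible_subgroups A \<H> F"
  shows "{x \<in> E \<rightarrow>\<^sub>E carrier A. reindex f F x \<in> K} \<in> admissible_subgroups A \<H> E" (is "?V \<in> _")
proof -
  have F: "finite F" using finite_imageD[OF finite_subset[OF _ E] f(2)] f(1) by blast
  have E0: "E \<noteq> {}" using F0 f by auto
  obtain b c h where b: "bij_betw b {1..card E} E" and c: "bij_betw c {1..card F} F"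
    and h: "h \<in> {1..card F} \<rightarrow> {1..card E}" "inj_on h {1..card F}"
    and eq: "\<forall>x::'e \<Rightarrow> 'a. reindex c {1..card F} (reindex f F x) = reindex h {1..card F} (reindex b {1..card E} x)"
    using obtain_coordinates[OF E f] .
  let ?I = "{1..card F}" and ?J = "{1..card E}"
  have le: "card F \<le> card E" using card_inj_on_le[OF f(2) _ E] f(1) by blast
  have n: "card F \<ge> 1" using F F0 by (simp add: Suc_leI card_gt_0_iff)
  have Ksub: "K \<subseteq> F \<rightarrow>\<^sub>E carrier A" using admissible_subset[OF K] .
  have KH: "reindex c ?I ` K \<in> \<H> (card F)"
    using admissible_subgroups_any_bij[OF F F0 c] K by blast
  have bJ: "b \<in> ?J \<rightarrow> E" "b ` ?J = E" using b by (auto simp: bij_betw_def)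
  have "reindex b ?J ` ?V = {y \<in> carrier (power_group A ?J). reindex h ?I y \<in> reindex c ?I ` K}"
  proof (intro equalityI subsetI)
    fix y assume "y \<in> reindex b ?J ` ?V"
    then obtain x where x: "x \<in> E \<rightarrow>\<^sub>E carrier A" "reindex f F x \<in> K" "y = reindex b ?J x" by auto
    have "reindex h ?I y = reindex c ?I (reindex f F x)" using spec[OF eq, of x] x(3) by simp
    then have "reindex h ?I y \<in> reindex c ?I ` K" using x(2) by (rule image_eqI)
    then show "y \<in> {y \<in> carrier (power_group A ?J). reindex h ?I y \<in> reindex c ?I ` K}"
      using reindex_PiE[OF bJ(1) x(1)] x(3) by simp
  next
    fix y assume "y \<in> {y \<in> carrier (power_group A ?J). reindex h ?I y \<in> reindex c ?I ` K}"
    then have y: "y \<in> ?J \<rightarrow>\<^sub>E carrier A" and yK: "reindex h ?I y \<in> reindex c ?I ` K" by auto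
    define x where "x = reindex (inv_into ?J b) E y"
    have x: "x \<in> E \<rightarrow>\<^sub>E carrier A" unfolding x_def
      using y bJ(2) by (intro reindex_PiE[of _ E ?J] Pi_I inv_into_into) auto
    have "y = reindex b ?J x" unfolding x_def
      unfolding reindex_reindex[OF bJ(1)]
      using b y by (intro reindex_ident[symmetric]) (auto simp: bij_betw_def)
    moreover have "reindex f F x \<in> K"
    proof -
      obtain k where k: "k \<in> K" "reindex h ?I y = reindex c ?I k" using yK by auto
      have "reindex c ?I (reindex f F x) = reindex c ?I k" using spec[OF eq, of x] k \<open>y = _\<close> by simp
      moreover have "reindex f F x \<in> F \<rightarrow>\<^sub>E carrier A" using reindex_PiE[OF f(1) x] .
      moreover have "c ` ?I = F" using c by (auto simp: bij_betw_def)
      ultimately have "reindex f F x = k"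
        using inj_onD[OF inj_on_reindex] subsetD[OF Ksub k(1)] by metis
      then show ?thesis using k by simp
    qed
    ultimately show "y \<in> reindex b ?J ` ?V" using x by blast
  qed
  also have "\<dots> \<in> \<H> (card E)" using vimage_admissible[OF n le h KH] .
  finally show ?thesis using admissible_transfer[OF E E0 b, of ?V] by blast
qed

text \<open>Fullness is postulated for exponent 1 only. Pulling it back along a single coordinate
  covers every nonempty \<open>E\<close>, and the convention for exponent 0 covers the rest.\<close>

lemma admissible_full:
  assumes "finite E"
  shows "E \<rightarrow>\<^sub>E carrier A \<in> admissible_subgroups A \<H> E"
proof (cases "E = {}")
  case False
  then obtain i where i: "i \<in> E" by blast
  have "{x \<in> E \<rightarrow>\<^sub>E carrier A. reindex (\<lambda>j. j) {i} x \<in> {i} \<rightarrow>\<^sub>E carrier A} = E \<rightarrow>\<^sub>E carrier A"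
    using i by (auto simp: reindex_def)
  then show ?thesis
    using admissible_vimage_nonempty[OF assms _ _ _ admissible_full_singleton, of "\<lambda>j. j" i] i by auto
qed (simp add: admissible_empty_iff)

lemma admissible_vimage:
  fixes f :: "'f \<Rightarrow> 'e"
  assumes E: "finite E" and f: "f \<in> F \<rightarrow> E" "inj_on f F"
    and K: "K \<in> admissible_subgroups A \<H> F"
  shows "{x \<in> E \<rightarrow>\<^sub>E carrier A. reindex f F x \<in> K} \<in> admissible_subgroups A \<H> E"
proof (cases "F = {}")
  case True
  then have "{x \<in> E \<rightarrow>\<^sub>E carrier A. reindex f F x \<in> K} = E \<rightarrow>\<^sub>E carrier A"
    using K by (auto simp: admissible_empty_iff reindex_def)
  then show ?thesis using admissible_full[OF E] by simp
next
  case False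
  then show ?thesis using admissible_vimage_nonempty assms by blast
qed

lemma admissible_Int:
  assumes E: "finite E" and K: "K \<in> admissible_subgroups A \<H> E" and L: "L \<in> admissible_subgroups A \<H> E"
  shows "K \<inter> L \<in> admissible_subgroups A \<H> E"
proof (cases "E = {}")
  case True
  then show ?thesis using K L by (simp add: admissible_empty_iff)
next
  case False
  obtain b where b: "bij_betw b {1..card E} E" using obtain_bij[OF E] .
  have n: "card E \<ge> 1" using E False by (simp add: Suc_leI card_gt_0_iff)
  have "b ` {1..card E} = E" using b by (simp add: bij_betw_def)
  then have "reindex b {1..card E} ` (K \<inter> L) = reindex b {1..card E} ` K \<inter> reindex b {1..card E} ` L"
    using inj_on_image_Int[OF inj_on_reindex admissible_subset[OF K] admissible_subset[OF L]] by blast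
  then show ?thesis
    using Int_admissible[OF n] admissible_subgroups_any_bij[OF E False b] K L by auto
qed

lemma admissible_descending_chain:
  fixes K :: "nat \<Rightarrow> ('e \<Rightarrow> 'a) set"
  assumes E: "finite E" and K: "\<And>i. K i \<in> admissible_subgroups A \<H> E" and dec: "\<And>i. K (Suc i) \<subseteq> K i"
  shows "\<exists>N. \<forall>i\<ge>N. K i = K N"
proof (cases "E = {}")
  case True
  then show ?thesis using K by (simp add: admissible_empty_iff)
next
  case False
  obtain b where b: "bij_betw b {1..card E} E" using obtain_bij[OF E] .
  have n: "card E \<ge> 1" using E False by (simp add: Suc_leI card_gt_0_iff)
  have bE: "b ` {1..card E} = E" using b by (simp add: bij_betw_def)
  have "\<exists>N. \<forall>i\<ge>N. reindex b {1..card E} ` K i = reindex b {1..card E} ` K N"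
  proof (rule descending_chain[OF n])
    show "reindex b {1..card E} ` K i \<in> \<H> (card E)" for i
      using admissible_subgroups_any_bij[OF E False b] K by blast
    show "reindex b {1..card E} ` K (Suc i) \<subseteq> reindex b {1..card E} ` K i" for i
      using dec by blast
  qed
  then show ?thesis
    by (simp only: inj_on_image_eq_iff[OF inj_on_reindex[OF bE] admissible_subset[OF K] admissible_subset[OF K]])
qed

lemma admissible_mult_inv_closed:
  assumes E: "finite E" and K: "K \<in> admissible_subgroups A \<H> E" and x: "x \<in> K" and y: "y \<in> K"
  shows "(\<lambda>i\<in>E. x i \<otimes> y i) \<in> K" and "(\<lambda>i\<in>E. inv (x i)) \<in> K"
proof -
  have "(\<lambda>i\<in>E. x i \<otimes> y i) \<in> K \<and> (\<lambda>i\<in>E. inv (x i)) \<in> K"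
  proof (cases "E = {}")
    case True
    then show ?thesis using K by (simp add: admissible_empty_iff restrict_def)
  next
    case False
    obtain b where b: "bij_betw b {1..card E} E" using obtain_bij[OF E] .
    have n: "card E \<ge> 1" using E False by (simp add: Suc_leI card_gt_0_iff)
    let ?J = "{1..card E}"
    have bE: "b ` ?J = E" and bJ: "b \<in> ?J \<rightarrow> E" using b by (auto simp add: bij_betw_def)
    note Ksub = admissible_subset[OF K]
    have H: "subgroup (reindex b ?J ` K) (power_group A ?J)"
      using admissible_subgroup[OF n] admissible_subgroups_any_bij[OF E False b] K by blast
    have mem: "z \<in> K" if "z \<in> E \<rightarrow>\<^sub>E carrier A" "reindex b ?J z \<in> reindex b ?J ` K" for z
      using that Ksub inj_on_reindex[OF bE, of "carrier A"] by (auto dest: inj_onD)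
    have xy: "x \<in> E \<rightarrow>\<^sub>E carrier A" "y \<in> E \<rightarrow>\<^sub>E carrier A" using x y Ksub by auto
    have "reindex b ?J (\<lambda>i\<in>E. x i \<otimes> y i) = reindex b ?J x \<otimes>\<^bsub>power_group A ?J\<^esub> reindex b ?J y"
      using bJ by (auto simp: reindex_def fun_eq_iff restrict_def)
    then have m: "reindex b ?J (\<lambda>i\<in>E. x i \<otimes> y i) \<in> reindex b ?J ` K"
      using subgroup.m_closed[OF H] x y by simp
    have bx: "reindex b ?J x \<in> (\<Pi>\<^sub>E i\<in>?J. carrier A)" using reindex_PiE[OF bJ xy(1)] .
    have "reindex b ?J (\<lambda>i\<in>E. inv (x i)) = inv\<^bsub>power_group A ?J\<^esub> reindex b ?J x"
      using bJ by (subst inv_product_group[OF bx]) (auto simp: reindex_def fun_eq_iff restrict_def is_group)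
    then have i: "reindex b ?J (\<lambda>i\<in>E. inv (x i)) \<in> reindex b ?J ` K"
      using subgroup.m_inv_closed[OF H] x by simp
    show ?thesis using xy by (intro conjI mem m i) auto
  qed
  then show "(\<lambda>i\<in>E. x i \<otimes> y i) \<in> K" "(\<lambda>i\<in>E. inv (x i)) \<in> K" by auto
qed

end


lemma (in admissible_artinian_group_structure) admissible_Collect_Ball:
  assumes E: "finite E" and K: "K \<in> admissible_subgroups A \<H> E" and C: "finite C"
    and P: "\<And>c. c \<in> C \<Longrightarrow> {z \<in> E \<rightarrow>\<^sub>E carrier A. P c z} \<in> admissible_subgroups A \<H> E"
  shows "{z \<in> K. \<forall>c\<in>C. P c z} \<in> admissible_subgroups A \<H> E"
  using C P
proof (induction C rule: finite_induct)
  case empty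
  then show ?case using K by simp
next
  case (insert c C)
  have "{z \<in> K. \<forall>c\<in>C. P c z} \<inter> {z \<in> E \<rightarrow>\<^sub>E carrier A. P c z} \<in> admissible_subgroups A \<H> E"
    using insert by (intro admissible_Int[OF E]) auto
  moreover have "{z \<in> K. \<forall>c\<in>C. P c z} \<inter> {z \<in> E \<rightarrow>\<^sub>E carrier A. P c z} = {z \<in> K. \<forall>c\<in>insert c C. P c z}"
    using admissible_subset[OF K] by blast
  ultimately show ?case by simp
qed

section \<open>Admissibility of constrained windows\<close>

text \<open>The assumption \<open>id_in_\<Gamma>\<close> has real content: the admissible local map
  of the identity is the source of the equality relation in
  \<open>diagonal_admissible\<close>.\<close>

locale admissible_group_subshift_action = admissible_artinian_group_structure A \<H> + G: monoid G
  for A :: "('a, 'c) monoid_scheme" (structure) and \<H> and G :: "('g, 'b) monoid_scheme" +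
  fixes \<Sigma> :: "('g \<Rightarrow> 'a) set" and \<Gamma> :: "(('g \<Rightarrow> 'a) \<Rightarrow> ('g \<Rightarrow> 'a)) set"
  assumes group_subshift: "admissible_group_subshift G A \<H> \<Sigma>"
    and endomorphisms: "\<Gamma> \<subseteq> carrier (End_grp G A \<H> \<Sigma>)"
    and id_in_\<Gamma>: "(\<lambda>x\<in>\<Sigma>. x) \<in> \<Gamma>"
begin

section \<open>The subshift as a group and the endomorphisms as local homomorphisms\<close>

lemma \<Sigma>_configurations: "\<Sigma> \<subseteq> carrier G \<rightarrow>\<^sub>E carrier A"
  using group_subshift by (simp add: admissible_group_subshift_def subshift_def)

lemma \<Sigma>_value: "x \<in> \<Sigma> \<Longrightarrow> g \<in> carrier G \<Longrightarrow> x g \<in> carrier A"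
  using \<Sigma>_configurations by auto

lemma shift_in_\<Sigma>: "x \<in> \<Sigma> \<Longrightarrow> g \<in> carrier G \<Longrightarrow> shift G g x \<in> \<Sigma>"
  using group_subshift by (simp add: admissible_group_subshift_def subshift_def)

lemma window_admissible:
  "finite E \<Longrightarrow> E \<subseteq> carrier G \<Longrightarrow> (\<lambda>x. restrict x E) ` \<Sigma> \<in> admissible_subgroups A \<H> E"
  using group_subshift by (simp add: admissible_group_subshift_def)

lemma \<Gamma>_maps: "\<gamma> \<in> \<Gamma> \<Longrightarrow> x \<in> \<Sigma> \<Longrightarrow> \<gamma> x \<in> \<Sigma>"
  using endomorphisms by (auto simp: End_grp_def)

text \<open>A basic neighbourhood in the prodiscrete topology restricts finitely many coordinates,
  so a point whose finite windows all occur in \<Sigma> cannot lie in the open complement. This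
  turns facts about windows into facts about \<Sigma>.\<close>

lemma in_\<Sigma>I:
  assumes x: "x \<in> carrier G \<rightarrow>\<^sub>E carrier A"
    and win: "\<And>E. finite E \<Longrightarrow> E \<subseteq> carrier G \<Longrightarrow> \<exists>y\<in>\<Sigma>. \<forall>g\<in>E. y g = x g"
  shows "x \<in> \<Sigma>"
proof (rule ccontr)
  assume "x \<notin> \<Sigma>"
  let ?T = "product_topology (\<lambda>_. discrete_topology (carrier A)) (carrier G)"
  have "closedin ?T \<Sigma>" using group_subshift by (simp add: admissible_group_subshift_def)
  then have "openin ?T ((carrier G \<rightarrow>\<^sub>E carrier A) - \<Sigma>)" by (simp add: closedin_def)
  then have "\<forall>x \<in> (carrier G \<rightarrow>\<^sub>E carrier A) - \<Sigma>. \<exists>U. finite {i \<in> carrier G. U i \<noteq> carrier A} \<and>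
      x \<in> Pi\<^sub>E (carrier G) U \<and> Pi\<^sub>E (carrier G) U \<subseteq> (carrier G \<rightarrow>\<^sub>E carrier A) - \<Sigma>"
    unfolding openin_product_topology_alt by simp meson
  then obtain U where U: "finite {i \<in> carrier G. U i \<noteq> carrier A}" "x \<in> Pi\<^sub>E (carrier G) U"
    and sub: "Pi\<^sub>E (carrier G) U \<subseteq> (carrier G \<rightarrow>\<^sub>E carrier A) - \<Sigma>"
    using x \<open>x \<notin> \<Sigma>\<close> by blast
  obtain y where y: "y \<in> \<Sigma>" "\<forall>g\<in>{i \<in> carrier G. U i \<noteq> carrier A}. y g = x g"
    using win[OF U(1)] by blast
  have yc: "y \<in> carrier G \<rightarrow>\<^sub>E carrier A" using y(1) \<Sigma>_configurations by blast
  have "y \<in> Pi\<^sub>E (carrier G) U"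
  proof (rule PiE_I)
    show "y g \<in> U g" if "g \<in> carrier G" for g
      using that y(2) U(2) yc by (cases "U g = carrier A") auto
    show "y g = undefined" if "g \<notin> carrier G" for g using yc that by (auto simp: PiE_def extensional_def)
  qed
  then show False using sub y(1) by blast
qed

lemma local_map:
  assumes "\<gamma> \<in> \<Gamma>"
  obtains M \<mu> where "finite M" "M \<subseteq> carrier G"
    "admissible_hom A \<H> M {1..1::nat} (\<lambda>u. \<lambda>i\<in>{1..1}. \<mu> u)"
    "\<forall>x\<in>\<Sigma>. \<forall>g\<in>carrier G. \<gamma> x g = \<mu> (\<lambda>h\<in>M. x (h \<otimes>\<^bsub>G\<^esub> g))"
proof -
  obtain \<tau> M \<mu> where ca: "cellular_automaton_with G A M \<mu> \<tau>"
    and hom: "admissible_hom A \<H> M {1..1::nat} (\<lambda>x. \<lambda>i\<in>{1..1}. \<mu> x)" and eq: "\<forall>x\<in>\<Sigma>. \<gamma> x = \<tau> x"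
    using subsetD[OF endomorphisms assms] by (auto simp: End_grp_def)
  have M: "finite M" "M \<subseteq> carrier G" using ca by (auto simp: cellular_automaton_with_def)
  have "restrict (shift G g x) M = (\<lambda>h\<in>M. x (h \<otimes>\<^bsub>G\<^esub> g))" for g and x :: "'g \<Rightarrow> 'a"
    using M(2) by (auto simp: shift_def fun_eq_iff restrict_def)
  then have "\<forall>x\<in>\<Sigma>. \<forall>g\<in>carrier G. \<gamma> x g = \<mu> (\<lambda>h\<in>M. x (h \<otimes>\<^bsub>G\<^esub> g))"
    using ca eq \<Sigma>_configurations by (simp add: cellular_automaton_with_def subset_iff)
  then show thesis using that M hom by blast
qed

lemma finite_memory:
  assumes "\<gamma> \<in> \<Gamma>" "finite E" "E \<subseteq> carrier G"
  obtains F where "finite F" "F \<subseteq> carrier G"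
    "\<forall>x\<in>\<Sigma>. \<forall>y\<in>\<Sigma>. (\<forall>g\<in>F. x g = y g) \<longrightarrow> (\<forall>g\<in>E. \<gamma> x g = \<gamma> y g)"
proof -
  obtain M \<mu> where M: "finite M" "M \<subseteq> carrier G"
    and \<mu>: "\<forall>x\<in>\<Sigma>. \<forall>g\<in>carrier G. \<gamma> x g = \<mu> (\<lambda>h\<in>M. x (h \<otimes>\<^bsub>G\<^esub> g))"
    using local_map[OF assms(1)] by metis
  define F where "F = (\<lambda>(h, g). h \<otimes>\<^bsub>G\<^esub> g) ` (M \<times> E)"
  have "\<gamma> x g = \<gamma> y g" if "x \<in> \<Sigma>" "y \<in> \<Sigma>" "\<forall>g\<in>F. x g = y g" "g \<in> E" for x y g
  proof -
    have "(\<lambda>h\<in>M. x (h \<otimes>\<^bsub>G\<^esub> g)) = (\<lambda>h\<in>M. y (h \<otimes>\<^bsub>G\<^esub> g))"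
      using that by (intro restrict_ext) (auto simp: F_def)
    then show ?thesis using that \<mu> assms(3) by auto
  qed
  moreover have "finite F" "F \<subseteq> carrier G" using M assms unfolding F_def by auto
  ultimately show thesis using that by blast
qed

text \<open>Each finite window of \<Sigma> is closed under products, so the pointwise product agrees
  there with some point of \<Sigma>; closedness of \<Sigma> does the rest.\<close>

lemma mult_in_\<Sigma>:
  assumes "x \<in> \<Sigma>" "y \<in> \<Sigma>"
  shows "(\<lambda>g\<in>carrier G. x g \<otimes> y g) \<in> \<Sigma>"
proof (rule in_\<Sigma>I)
  fix E assume E: "finite E" "E \<subseteq> carrier G"
  have "(\<lambda>g\<in>E. restrict x E g \<otimes> restrict y E g) \<in> (\<lambda>x. restrict x E) ` \<Sigma>"
    by (intro admissible_mult_inv_closed[OF E(1) window_admissible[OF E]] imageI assms)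
  then obtain z where "z \<in> \<Sigma>" "(\<lambda>g\<in>E. restrict x E g \<otimes> restrict y E g) = restrict z E" by auto
  then show "\<exists>z\<in>\<Sigma>. \<forall>g\<in>E. z g = (\<lambda>g\<in>carrier G. x g \<otimes> y g) g"
    using E by (intro bexI[of _ z]) (auto simp: fun_eq_iff restrict_def subset_iff, metis)
qed (use assms \<Sigma>_value in auto)

lemma inv_in_\<Sigma>:
  assumes "x \<in> \<Sigma>"
  shows "(\<lambda>g\<in>carrier G. inv (x g)) \<in> \<Sigma>"
proof (rule in_\<Sigma>I)
  fix E assume E: "finite E" "E \<subseteq> carrier G"
  have "(\<lambda>g\<in>E. inv (restrict x E g)) \<in> (\<lambda>x. restrict x E) ` \<Sigma>"
    by (rule admissible_mult_inv_closed(2)[OF E(1) window_admissible[OF E] imageI[OF assms] imageI[OF assms]])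
  then obtain z where "z \<in> \<Sigma>" "(\<lambda>g\<in>E. inv (restrict x E g)) = restrict z E" by auto
  then show "\<exists>z\<in>\<Sigma>. \<forall>g\<in>E. z g = (\<lambda>g\<in>carrier G. inv (x g)) g"
    using E by (intro bexI[of _ z]) (auto simp: fun_eq_iff restrict_def subset_iff, metis)
qed (use assms \<Sigma>_value in auto)

lemma \<Gamma>_mult:
  assumes \<gamma>: "\<gamma> \<in> \<Gamma>" and x: "x \<in> \<Sigma>" and y: "y \<in> \<Sigma>" and g: "g \<in> carrier G"
  shows "\<gamma> (\<lambda>g\<in>carrier G. x g \<otimes> y g) g = \<gamma> x g \<otimes> \<gamma> y g"
proof -
  obtain M \<mu> where M: "finite M" "M \<subseteq> carrier G"
    and hom: "admissible_hom A \<H> M {1..1::nat} (\<lambda>u. \<lambda>i\<in>{1..1}. \<mu> u)"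
    and \<mu>: "\<forall>x\<in>\<Sigma>. \<forall>g\<in>carrier G. \<gamma> x g = \<mu> (\<lambda>h\<in>M. x (h \<otimes>\<^bsub>G\<^esub> g))"
    using local_map[OF \<gamma>] .
  let ?u = "\<lambda>x. \<lambda>h\<in>M. x (h \<otimes>\<^bsub>G\<^esub> g)"
  have c: "?u x \<in> carrier (power_group A M)" "?u y \<in> carrier (power_group A M)"
    using x y g M \<Sigma>_value by (auto simp: subset_iff)
  have "(\<lambda>u. \<lambda>i\<in>{1..1::nat}. \<mu> u) (?u x \<otimes>\<^bsub>power_group A M\<^esub> ?u y) =
      (\<lambda>i\<in>{1..1}. \<mu> (?u x)) \<otimes>\<^bsub>power_group A {1..1}\<^esub> (\<lambda>i\<in>{1..1}. \<mu> (?u y))"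
    using hom c unfolding admissible_hom_def by (intro hom_mult[of "\<lambda>u. \<lambda>i\<in>{1..1::nat}. \<mu> u"]) auto
  from fun_cong[OF this, of 1]
  have "\<mu> (?u x \<otimes>\<^bsub>power_group A M\<^esub> ?u y) = \<mu> (?u x) \<otimes> \<mu> (?u y)" by simp
  moreover have "?u x \<otimes>\<^bsub>power_group A M\<^esub> ?u y = ?u (\<lambda>g\<in>carrier G. x g \<otimes> y g)"
    using M g by (auto simp: fun_eq_iff restrict_def subset_iff)
  ultimately show ?thesis using \<mu> x y g mult_in_\<Sigma>[OF x y] by simp
qed

text \<open>Multiplicativity is applied to \<open>x = w y\<close>, where \<open>w\<close> is the
  pointwise quotient, and the right factor is cancelled. One \<open>w\<close> serves all of \<Gamma>
  at once.\<close>

lemma \<Gamma>_quotient: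
  assumes x: "x \<in> \<Sigma>" and y: "y \<in> \<Sigma>"
  obtains w where "w \<in> \<Sigma>" "\<forall>\<gamma>\<in>\<Gamma>. \<forall>g\<in>carrier G. \<gamma> w g = \<gamma> x g \<otimes> inv (\<gamma> y g)"
proof -
  define w where "w = (\<lambda>g\<in>carrier G. x g \<otimes> (\<lambda>g\<in>carrier G. inv (y g)) g)"
  have w: "w \<in> \<Sigma>" unfolding w_def by (rule mult_in_\<Sigma>[OF x inv_in_\<Sigma>[OF y]])
  have x_eq: "x = (\<lambda>g\<in>carrier G. w g \<otimes> y g)"
  proof
    fix g
    show "x g = (\<lambda>g\<in>carrier G. w g \<otimes> y g) g"
    proof (cases "g \<in> carrier G")
      case True
      then show ?thesis using \<Sigma>_value[OF x] \<Sigma>_value[OF y] by (simp add: w_def m_assoc)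
    next
      case False
      then show ?thesis using subsetD[OF \<Sigma>_configurations x] by (simp add: PiE_def extensional_def)
    qed
  qed
  have "\<gamma> w g = \<gamma> x g \<otimes> inv (\<gamma> y g)" if \<gamma>: "\<gamma> \<in> \<Gamma>" and g: "g \<in> carrier G" for \<gamma> g
  proof -
    have "\<gamma> x g = \<gamma> w g \<otimes> \<gamma> y g" using \<Gamma>_mult[OF \<gamma> w y g] x_eq by simp
    moreover have "\<gamma> w g \<in> carrier A" "\<gamma> y g \<in> carrier A"
      using \<Gamma>_maps[OF \<gamma>] w y \<Sigma>_value g by auto
    ultimately show ?thesis by (simp add: m_assoc)
  qed
  then show thesis using that w by blast
qed

text \<open>Indexing by pairs of an endomorphism and a site makes a value
  \<open>\<gamma> x g\<close> a single coordinate. A condition on it is then a preimage under a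
  projection, and forgetting it is a projection.\<close>

definition observe :: "((('g \<Rightarrow> 'a) \<Rightarrow> ('g \<Rightarrow> 'a)) \<times> 'g) set \<Rightarrow> ('g \<Rightarrow> 'a) \<Rightarrow> _ \<Rightarrow> 'a" where
  "observe I x = (\<lambda>p\<in>I. fst p x (snd p))"

text \<open>The diagonal of \<open>A^2\<close> need not be admissible. Its part over the values of \<open>\<Sigma>\<close> at one site is,
  because the identity of \<open>\<Sigma>\<close> has an admissible local map, whose graph can be intersected with a window of \<open>\<Sigma>\<close>.\<close>

lemma diagonal_admissible:
  "(\<lambda>x. \<lambda>b::bool\<in>UNIV. x \<one>\<^bsub>G\<^esub>) ` \<Sigma> \<in> admissible_subgroups A \<H> UNIV"
proof -
  obtain M \<mu> where M: "finite M" "M \<subseteq> carrier G"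
    and hom: "admissible_hom A \<H> M {1..1::nat} (\<lambda>u. \<lambda>i\<in>{1..1}. \<mu> u)"
    and \<mu>: "\<forall>x\<in>\<Sigma>. \<forall>g\<in>carrier G. (\<lambda>x\<in>\<Sigma>. x) x g = \<mu> (\<lambda>h\<in>M. x (h \<otimes>\<^bsub>G\<^esub> g))"
    using local_map[OF id_in_\<Gamma>] .
  have \<mu>1: "\<mu> (restrict x M) = x \<one>\<^bsub>G\<^esub>" if "x \<in> \<Sigma>" for x
  proof -
    have "(\<lambda>h\<in>M. x (h \<otimes>\<^bsub>G\<^esub> \<one>\<^bsub>G\<^esub>)) = restrict x M" using M(2) by (intro restrict_ext) auto
    then show ?thesis using bspec[OF bspec[OF \<mu> that] G.one_closed] that by simp
  qed
  define P where "P = M <+> {1..1::nat}"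
  define Gr where "Gr = (\<lambda>u. restrict (case_sum u (\<lambda>i\<in>{1..1}. \<mu> u)) P) ` carrier (power_group A M)"
  have Gr: "Gr \<in> admissible_subgroups A \<H> P"
    using hom by (simp add: admissible_hom_def Gr_def P_def)
  \<comment> \<open>\<open>M\<close> need not contain the identity site, whose value is to be
    compared with the output of \<open>\<mu>\<close>.\<close>
  define V where "V = insert \<one>\<^bsub>G\<^esub> M"
  define J where "J = V <+> {1..1::nat}"
  have fin: "finite J" "finite V" "V \<subseteq> carrier G" using M by (auto simp: J_def V_def)
  \<comment> \<open>A point of \<open>Z\<close> carries a window of some \<open>x\<close> and a
    point of the graph on the same coordinates \<open>M\<close>, which forces the argument of the
    graph point to be \<open>x\<close> restricted to \<open>M\<close>.\<close>
  define Z where "Z = {z \<in> J \<rightarrow>\<^sub>E carrier A. reindex Inl V z \<in> (\<lambda>x. restrict x V) ` \<Sigma>} \<inter>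
    {z \<in> J \<rightarrow>\<^sub>E carrier A. reindex (\<lambda>p. p) P z \<in> Gr}"
  have Z: "Z \<in> admissible_subgroups A \<H> J" unfolding Z_def
    by (intro admissible_Int fin admissible_vimage Gr window_admissible)
      (auto simp: J_def P_def V_def)
  define f where "f b = (if b then Inl \<one>\<^bsub>G\<^esub> else Inr (1::nat))" for b
  have fJ: "f \<in> UNIV \<rightarrow> J" "inj_on f UNIV"
    by (auto simp: f_def J_def V_def inj_on_def)
  have "reindex f UNIV ` Z = (\<lambda>x. \<lambda>b\<in>UNIV. x \<one>\<^bsub>G\<^esub>) ` \<Sigma>"
  proof (intro equalityI subsetI)
    fix d assume "d \<in> reindex f UNIV ` Z"
    then obtain z where z: "z \<in> Z" "d = reindex f UNIV z" by auto
    then obtain x u where x: "x \<in> \<Sigma>" "reindex Inl V z = restrict x V"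
      and u: "u \<in> carrier (power_group A M)"
        "reindex (\<lambda>p. p) P z = restrict (case_sum u (\<lambda>i\<in>{1..1}. \<mu> u)) P"
      by (auto simp: Z_def Gr_def)
    have zx: "z (Inl g) = x g" if "g \<in> V" for g
      using fun_cong[OF x(2), of g] that by (simp add: reindex_def)
    have zu: "z (Inl g) = u g" if "g \<in> M" for g
      using fun_cong[OF u(2), of "Inl g"] that by (simp add: reindex_def P_def InlI InrI)
    have "u = restrict x M"
      using u(1) zx zu by (auto simp: fun_eq_iff PiE_def extensional_def V_def restrict_def)
    moreover have "z (Inr 1) = \<mu> u"
      using fun_cong[OF u(2), of "Inr 1"] by (simp add: reindex_def P_def InlI InrI)
    ultimately have "z (Inr 1) = x \<one>\<^bsub>G\<^esub>" using \<mu>1[OF x(1)] by simp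
    then have "d = (\<lambda>b\<in>UNIV. x \<one>\<^bsub>G\<^esub>)"
      unfolding z(2) using zx[of "\<one>\<^bsub>G\<^esub>"] by (auto simp: reindex_def f_def V_def fun_eq_iff)
    then show "d \<in> (\<lambda>x. \<lambda>b\<in>UNIV. x \<one>\<^bsub>G\<^esub>) ` \<Sigma>" using x(1) by blast
  next
    fix d :: "bool \<Rightarrow> 'a" assume "d \<in> (\<lambda>x. \<lambda>b\<in>UNIV. x \<one>\<^bsub>G\<^esub>) ` \<Sigma>"
    then obtain x where x: "x \<in> \<Sigma>" "d = (\<lambda>b\<in>UNIV. x \<one>\<^bsub>G\<^esub>)" by auto
    define z where "z = restrict (case_sum x (\<lambda>_. x \<one>\<^bsub>G\<^esub>)) J"
    have zJ: "z \<in> J \<rightarrow>\<^sub>E carrier A"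
      unfolding z_def using \<Sigma>_value[OF x(1)] fin(3) by (auto simp: J_def)
    have 1: "reindex Inl V z = restrict x V"
      by (auto simp: z_def reindex_def J_def fun_eq_iff restrict_def)
    have "reindex (\<lambda>p. p) P z = restrict (case_sum (restrict x M) (\<lambda>i\<in>{1..1}. \<mu> (restrict x M))) P"
      using \<mu>1[OF x(1)]
      by (auto simp: z_def reindex_def J_def P_def V_def fun_eq_iff restrict_def split: sum.splits)
    moreover have "restrict x M \<in> carrier (power_group A M)"
      using \<Sigma>_value[OF x(1)] M(2) by auto
    ultimately have "reindex (\<lambda>p. p) P z \<in> Gr" unfolding Gr_def by blast
    then have "z \<in> Z" using zJ x(1) 1 unfolding Z_def by blast
    moreover have "d = reindex f UNIV z"
      unfolding x(2) z_def by (auto simp: reindex_def f_def J_def V_def fun_eq_iff)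
    ultimately show "d \<in> reindex f UNIV ` Z" by blast
  qed
  then show ?thesis using admissible_image[OF fin(1) fJ Z] by simp
qed

text \<open>Since \<open>G\<close> is only a monoid, \<open>h \<mapsto> h g\<close> need not be injective on the memory set \<open>M\<close>, so the graph of \<open>\<mu>\<close>
  cannot be pulled back along it. Instead the coordinates in \<open>M\<close> are adjoined as new ones and tied to the
  sites \<open>h g\<close> by the diagonal relation.\<close>

lemma observe_insert_admissible:
  assumes I: "finite I" and adm: "observe I ` \<Sigma> \<in> admissible_subgroups A \<H> I"
    and \<gamma>: "\<gamma> \<in> \<Gamma>" and g: "g \<in> carrier G"
    and M: "finite M" "M \<subseteq> carrier G"
    and hom: "admissible_hom A \<H> M {1..1::nat} (\<lambda>u. \<lambda>i\<in>{1..1}. \<mu> u)"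
    and \<mu>: "\<forall>x\<in>\<Sigma>. \<forall>g\<in>carrier G. \<gamma> x g = \<mu> (\<lambda>h\<in>M. x (h \<otimes>\<^bsub>G\<^esub> g))"
    and mem: "\<And>h. h \<in> M \<Longrightarrow> (\<lambda>x\<in>\<Sigma>. x, h \<otimes>\<^bsub>G\<^esub> g) \<in> I" and new: "(\<gamma>, g) \<notin> I"
    and IG: "I \<subseteq> \<Gamma> \<times> carrier G"
  shows "observe (insert (\<gamma>, g) I) ` \<Sigma> \<in> admissible_subgroups A \<H> (insert (\<gamma>, g) I)"
proof -
  define P where "P = M <+> {1..1::nat}"
  define Gr where "Gr = (\<lambda>u. restrict (case_sum u (\<lambda>i\<in>{1..1}. \<mu> u)) P) ` carrier (power_group A M)"
  have Gr: "Gr \<in> admissible_subgroups A \<H> P"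
    using hom by (simp add: admissible_hom_def Gr_def P_def)
  define J where "J = I <+> P"
  have fin: "finite J" using M I by (auto simp: J_def P_def)
  define d where "d h b = (if b then Inl (\<lambda>x\<in>\<Sigma>. x, h \<otimes>\<^bsub>G\<^esub> g) else Inr (Inl h :: 'g + nat))" for h :: 'g and b
  define D where "D = (\<lambda>x. \<lambda>b::bool\<in>UNIV. x \<one>\<^bsub>G\<^esub>) ` \<Sigma>"
  define Z where "Z = {z \<in> {z \<in> J \<rightarrow>\<^sub>E carrier A. reindex Inl I z \<in> observe I ` \<Sigma>} \<inter>
    {z \<in> J \<rightarrow>\<^sub>E carrier A. reindex Inr P z \<in> Gr}. \<forall>h\<in>M. reindex (d h) UNIV z \<in> D}"
  have Z: "Z \<in> admissible_subgroups A \<H> J" unfolding Z_def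
  proof (intro admissible_Collect_Ball admissible_Int fin M(1) admissible_vimage Gr adm)
    show "D \<in> admissible_subgroups A \<H> UNIV" unfolding D_def by (rule diagonal_admissible)
  qed (use mem in \<open>auto simp: J_def P_def d_def inj_on_def\<close>)
  define f where "f p = (if p \<in> I then Inl p else Inr (Inr 1 :: 'g + nat))" for p
  have fJ: "f \<in> insert (\<gamma>, g) I \<rightarrow> J" "inj_on f (insert (\<gamma>, g) I)"
    using new by (auto simp: f_def J_def P_def inj_on_def)
  have "reindex f (insert (\<gamma>, g) I) ` Z = observe (insert (\<gamma>, g) I) ` \<Sigma>"
  proof (intro equalityI subsetI)
    fix w assume "w \<in> reindex f (insert (\<gamma>, g) I) ` Z"
    then obtain z where z: "z \<in> Z" "w = reindex f (insert (\<gamma>, g) I) z" by auto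
    then obtain x u where x: "x \<in> \<Sigma>" "reindex Inl I z = observe I x"
      and u: "u \<in> carrier (power_group A M)"
        "reindex Inr P z = restrict (case_sum u (\<lambda>i\<in>{1..1}. \<mu> u)) P"
      by (auto simp: Z_def Gr_def)
    have zx: "z (Inl p) = fst p x (snd p)" if "p \<in> I" for p
      using fun_cong[OF x(2), of p] that by (simp add: reindex_def observe_def)
    have zu: "z (Inr (Inl h)) = u h" if "h \<in> M" for h
      using fun_cong[OF u(2), of "Inl h"] that by (simp add: reindex_def P_def InlI InrI)
    have z\<mu>: "z (Inr (Inr 1)) = \<mu> u"
      using fun_cong[OF u(2), of "Inr 1"] by (simp add: reindex_def P_def InlI InrI)
    have "u h = x (h \<otimes>\<^bsub>G\<^esub> g)" if h: "h \<in> M" for h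
    proof -
      \<comment> \<open>This \<open>y\<close> is unrelated to \<open>x\<close>: the diagonal
        relation is used only for the equality of its two coordinates.\<close>
      obtain y where "reindex (d h) UNIV z = (\<lambda>b\<in>UNIV. y \<one>\<^bsub>G\<^esub>)"
        using z(1) h by (auto simp: Z_def D_def)
      then have "z (d h True) = z (d h False)" by (simp add: reindex_def fun_eq_iff)
      then show ?thesis using zx[OF mem[OF h]] zu[OF h] x(1) by (simp add: d_def)
    qed
    then have "u = (\<lambda>h\<in>M. x (h \<otimes>\<^bsub>G\<^esub> g))"
      using u(1) by (auto simp: fun_eq_iff PiE_def extensional_def)
    then have "z (Inr (Inr 1)) = \<gamma> x g" using z\<mu> \<mu> x(1) g by simp
    then have "w = observe (insert (\<gamma>, g) I) x"
      unfolding z(2) using zx new by (auto simp: reindex_def f_def observe_def fun_eq_iff restrict_def)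
    then show "w \<in> observe (insert (\<gamma>, g) I) ` \<Sigma>" using x(1) by blast
  next
    fix w assume "w \<in> observe (insert (\<gamma>, g) I) ` \<Sigma>"
    then obtain x where x: "x \<in> \<Sigma>" "w = observe (insert (\<gamma>, g) I) x" by auto
    let ?u = "\<lambda>h\<in>M. x (h \<otimes>\<^bsub>G\<^esub> g)"
    define z where "z = restrict (case_sum (\<lambda>p. fst p x (snd p)) (case_sum ?u (\<lambda>_. \<gamma> x g))) J"
    have u: "?u \<in> carrier (power_group A M)" using \<Sigma>_value[OF x(1)] M(2) g by auto
    have zJ: "z \<in> J \<rightarrow>\<^sub>E carrier A" unfolding z_def
    proof (rule restrict_PiE_iff[THEN iffD2], intro ballI)
      fix j assume "j \<in> J"
      then consider p where "j = Inl p" "p \<in> I" | h where "j = Inr (Inl h)" "h \<in> M" | "j = Inr (Inr 1)"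
        by (auto simp: J_def P_def)
      then show "case_sum (\<lambda>p. fst p x (snd p)) (case_sum ?u (\<lambda>_. \<gamma> x g)) j \<in> carrier A"
      proof cases
        case 1
        then show ?thesis using IG x(1) \<Gamma>_maps \<Sigma>_value by auto
      next
        case 2
        then show ?thesis using x(1) \<Sigma>_value M(2) g by auto
      next
        case 3
        then show ?thesis using x(1) \<Gamma>_maps[OF \<gamma>] \<Sigma>_value g by auto
      qed
    qed
    have 1: "reindex Inl I z = observe I x"
      by (auto simp: z_def reindex_def J_def observe_def fun_eq_iff restrict_def)
    have "reindex Inr P z = restrict (case_sum ?u (\<lambda>i\<in>{1..1}. \<mu> ?u)) P"
      using \<mu> x(1) g
      by (auto simp: z_def reindex_def J_def P_def fun_eq_iff restrict_def split: sum.splits)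
    then have 2: "reindex Inr P z \<in> Gr" using u unfolding Gr_def by blast
    have 3: "reindex (d h) UNIV z \<in> D" if h: "h \<in> M" for h
    proof -
      have hg: "h \<otimes>\<^bsub>G\<^esub> g \<in> carrier G" using M(2) h g by auto
      \<comment> \<open>\<open>D\<close> describes pairs of equal values at the identity site;
        shifting \<open>x\<close> by \<open>h g\<close> brings the value at \<open>h g\<close> to
        that site.\<close>
      have "reindex (d h) UNIV z = (\<lambda>b\<in>UNIV. shift G (h \<otimes>\<^bsub>G\<^esub> g) x \<one>\<^bsub>G\<^esub>)"
        using h hg x(1) mem[OF h]
        by (auto simp: reindex_def d_def z_def J_def P_def fun_eq_iff shift_def)
      then show ?thesis unfolding D_def using shift_in_\<Sigma>[OF x(1) hg] by blast
    qed
    have "z \<in> Z" using zJ x(1) 2 3 unfolding Z_def 1[symmetric] by (auto simp: 1)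
    moreover have "w = reindex f (insert (\<gamma>, g) I) z"
      unfolding x(2) z_def using new by (auto simp: reindex_def f_def observe_def J_def P_def fun_eq_iff restrict_def)
    ultimately show "w \<in> reindex f (insert (\<gamma>, g) I) ` Z" by blast
  qed
  then show ?thesis using admissible_image[OF fin fJ Z] by simp
qed

lemma observe_subset_admissible:
  assumes "finite J" "observe J ` \<Sigma> \<in> admissible_subgroups A \<H> J" "I \<subseteq> J"
  shows "observe I ` \<Sigma> \<in> admissible_subgroups A \<H> I"
proof -
  have "reindex (\<lambda>p. p) I ` (observe J ` \<Sigma>) = observe I ` \<Sigma>"
    unfolding image_image using assms(3)
    by (intro image_cong) (auto simp: reindex_def observe_def fun_eq_iff restrict_def)
  moreover have "reindex (\<lambda>p. p) I ` (observe J ` \<Sigma>) \<in> admissible_subgroups A \<H> I"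
    using assms by (intro admissible_image) auto
  ultimately show ?thesis by simp
qed

lemma observe_sites_admissible:
  assumes "finite V" "V \<subseteq> carrier G"
  shows "observe ({\<lambda>x\<in>\<Sigma>. x} \<times> V) ` \<Sigma> \<in> admissible_subgroups A \<H> ({\<lambda>x\<in>\<Sigma>. x} \<times> V)"
proof -
  have "reindex snd ({\<lambda>x\<in>\<Sigma>. x} \<times> V) ` ((\<lambda>x. restrict x V) ` \<Sigma>) = observe ({\<lambda>x\<in>\<Sigma>. x} \<times> V) ` \<Sigma>"
    unfolding image_image
    by (intro image_cong) (auto simp: reindex_def observe_def fun_eq_iff restrict_def)
  moreover have "reindex snd ({\<lambda>x\<in>\<Sigma>. x} \<times> V) ` ((\<lambda>x. restrict x V) ` \<Sigma>)
      \<in> admissible_subgroups A \<H> ({\<lambda>x\<in>\<Sigma>. x} \<times> V)"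
    using assms by (intro admissible_image[OF _ _ _ window_admissible]) (auto simp: inj_on_def)
  ultimately show ?thesis by (simp only:)
qed

text \<open>The induction is over \<open>I\<close>, strengthened by an arbitrary finite set
  \<open>V\<close> of extra sites observed through the identity. Adding \<open>(\<gamma>, g)\<close>
  requires the sites \<open>h g\<close> read by the local map to be observed already; the hypothesis
  supplies them through a larger \<open>V\<close>, and a projection discards the surplus
  afterwards.\<close>

lemma observe_admissible:
  assumes "finite I" "I \<subseteq> \<Gamma> \<times> carrier G"
  shows "observe I ` \<Sigma> \<in> admissible_subgroups A \<H> I"
proof -
  let ?id = "\<lambda>x\<in>\<Sigma>. x"
  have "\<forall>V. finite V \<longrightarrow> V \<subseteq> carrier G \<longrightarrow>
      observe (I \<union> {?id} \<times> V) ` \<Sigma> \<in> admissible_subgroups A \<H> (I \<union> {?id} \<times> V)"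
    using assms
  proof (induction I rule: finite_induct)
    case empty
    then show ?case unfolding Un_empty_left using observe_sites_admissible by blast
  next
    case (insert p I)
    obtain \<gamma> g where p: "p = (\<gamma>, g)" and \<gamma>: "\<gamma> \<in> \<Gamma>" and g: "g \<in> carrier G"
      using insert.prems by auto
    obtain M \<mu> where M: "finite M" "M \<subseteq> carrier G"
      and hom: "admissible_hom A \<H> M {1..1::nat} (\<lambda>u. \<lambda>i\<in>{1..1}. \<mu> u)"
      and \<mu>: "\<forall>x\<in>\<Sigma>. \<forall>g\<in>carrier G. \<gamma> x g = \<mu> (\<lambda>h\<in>M. x (h \<otimes>\<^bsub>G\<^esub> g))"
      using local_map[OF \<gamma>] .
    show ?case
    proof (intro allI impI)
      fix V assume V: "finite V" "V \<subseteq> carrier G"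
      define V' where "V' = V \<union> (\<lambda>h. h \<otimes>\<^bsub>G\<^esub> g) ` M"
      have V': "finite V'" "V' \<subseteq> carrier G" using V M g by (auto simp: V'_def)
      let ?I = "I \<union> {?id} \<times> V'"
      have finI: "finite ?I" and IG: "?I \<subseteq> \<Gamma> \<times> carrier G"
        using insert V' id_in_\<Gamma> by auto
      have IH: "observe ?I ` \<Sigma> \<in> admissible_subgroups A \<H> ?I"
        using insert.IH insert.prems V' by blast
      have sub: "insert p I \<union> {?id} \<times> V \<subseteq> insert p ?I" unfolding V'_def by blast
      have a: "observe (insert p ?I) ` \<Sigma> \<in> admissible_subgroups A \<H> (insert p ?I)"
      proof (cases "p \<in> ?I")
        case True
        then show ?thesis using IH by (simp add: insert_absorb)
      next
        case False
        then show ?thesis unfolding p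
          by (intro observe_insert_admissible[OF finI IH \<gamma> g M hom \<mu> _ _ IG]) (auto simp: V'_def)
      qed
      show "observe (insert p I \<union> {?id} \<times> V) ` \<Sigma>
          \<in> admissible_subgroups A \<H> (insert p I \<union> {?id} \<times> V)"
        by (rule observe_subset_admissible[OF finite.insertI[OF finI] a sub])
    qed
  qed
  from spec[OF this, of "{}"] show ?thesis by simp
qed

text \<open>The constrained values and the values of \<open>\<gamma>\<close> on \<open>W\<close> are
  observed together. Each constraint is an intersection with the preimage of a trivial subgroup, and
  the image is the projection to the coordinates of \<open>\<gamma>\<close>.\<close>

lemma constrained_image_admissible:
  assumes \<gamma>: "\<gamma> \<in> \<Gamma>" and W: "finite W" "W \<subseteq> carrier G" and C: "finite C" "C \<subseteq> \<Gamma> \<times> carrier G"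
  shows "(\<lambda>x. restrict (\<gamma> x) W) ` {x \<in> \<Sigma>. \<forall>p\<in>C. fst p x (snd p) = \<one>} \<in> admissible_subgroups A \<H> W"
proof -
  define I where "I = {\<gamma>} \<times> W \<union> C"
  have I: "finite I" "I \<subseteq> \<Gamma> \<times> carrier G" using assms by (auto simp: I_def)
  define K where "K = {z \<in> observe I ` \<Sigma>. \<forall>p\<in>C. z p = \<one>}"
  have "{z \<in> I \<rightarrow>\<^sub>E carrier A. z p = \<one>} \<in> admissible_subgroups A \<H> I" if "p \<in> C" for p
  proof -
    have "{z \<in> I \<rightarrow>\<^sub>E carrier A. reindex (\<lambda>p. p) {p} z \<in> {x \<in> {p} \<rightarrow>\<^sub>E carrier A. x p = \<one>}}
        \<in> admissible_subgroups A \<H> I"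
      using that by (intro admissible_vimage I admissible_trivial) (auto simp: I_def)
    moreover have "{z \<in> I \<rightarrow>\<^sub>E carrier A. reindex (\<lambda>p. p) {p} z \<in> {x \<in> {p} \<rightarrow>\<^sub>E carrier A. x p = \<one>}} =
        {z \<in> I \<rightarrow>\<^sub>E carrier A. z p = \<one>}"
      using that by (auto simp: reindex_def I_def)
    ultimately show ?thesis by simp
  qed
  then have K: "K \<in> admissible_subgroups A \<H> I"
    unfolding K_def by (intro admissible_Collect_Ball I observe_admissible C)
  have "reindex (\<lambda>g. (\<gamma>, g)) W ` K = (\<lambda>x. restrict (\<gamma> x) W) ` {x \<in> \<Sigma>. \<forall>p\<in>C. fst p x (snd p) = \<one>}"
  proof -
    have "K = observe I ` {x \<in> \<Sigma>. \<forall>p\<in>C. fst p x (snd p) = \<one>}"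
      unfolding K_def by (auto simp: observe_def I_def)
    moreover have "reindex (\<lambda>g. (\<gamma>, g)) W (observe I x) = restrict (\<gamma> x) W" for x
      by (auto simp: reindex_def observe_def I_def fun_eq_iff restrict_def)
    ultimately show ?thesis by (simp add: image_image)
  qed
  moreover have "reindex (\<lambda>g. (\<gamma>, g)) W ` K \<in> admissible_subgroups A \<H> W"
    by (intro admissible_image[OF I(1) _ _ K]) (auto simp: I_def inj_on_def)
  ultimately show ?thesis by simp
qed

end


section \<open>Monomials in a finitely generated commutative monoid\<close>

text \<open>A monotone subsequence that decreases is eventually constant at its least value, hence
  nondecreasing once an initial part is dropped.\<close>

lemma nat_sequence_incseq_subseq:
  fixes t :: "nat \<Rightarrow> nat"
  shows "\<exists>f :: nat \<Rightarrow> nat. strict_mono f \<and> incseq (t \<circ> f)"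
proof -
  obtain f where f: "strict_mono f" "monoseq (t \<circ> f)"
    using seq_monosub[of t] by (auto simp: comp_def)
  show ?thesis
  proof (cases "incseq (t \<circ> f)")
    case False
    then have dec: "decseq (t \<circ> f)" using f(2) by (simp add: monoseq_iff)
    define m where "m = (LEAST k. \<exists>i. t (f i) = k)"
    have "\<exists>i. t (f i) = m" unfolding m_def by (rule LeastI_ex) blast
    then obtain N where N: "t (f N) = m" by blast
    have "t (f i) = m" if "i \<ge> N" for i
    proof (rule antisym)
      show "t (f i) \<le> m" using decseqD[OF dec that] N by simp
      show "m \<le> t (f i)" unfolding m_def by (rule Least_le) blast
    qed
    then have "incseq (t \<circ> (\<lambda>i. f (i + N)))" by (auto simp: incseq_def)
    moreover have "strict_mono (\<lambda>i. f (i + N))"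
      using f(1) by (auto simp: strict_mono_def)
    ultimately show ?thesis by blast
  qed (use f in blast)
qed

lemma finite_family_incseq_subseq:
  fixes t :: "'i \<Rightarrow> nat \<Rightarrow> nat"
  assumes "finite P"
  shows "\<exists>f :: nat \<Rightarrow> nat. strict_mono f \<and> (\<forall>p\<in>P. incseq (t p \<circ> f))"
  using assms
proof (induction P rule: finite_induct)
  case empty
  have "strict_mono (\<lambda>i::nat. i)" by (simp add: strict_mono_def)
  then show ?case by blast
next
  case (insert p P)
  then obtain f where f: "strict_mono f" "\<forall>p\<in>P. incseq (t p \<circ> f)" by blast
  obtain g where g: "strict_mono g" "incseq ((t p \<circ> f) \<circ> g)"
    using nat_sequence_incseq_subseq by blast
  have "incseq (t q \<circ> (f \<circ> g))" if "q \<in> insert p P" for q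
  proof (cases "q = p")
    case True
    then show ?thesis using g(2) by (simp add: comp_assoc)
  next
    case False
    then show ?thesis
      using f(2) that g(1) by (auto simp: incseq_def strict_mono_less_eq)
  qed
  then show ?case using strict_mono_o[OF f(1) g(1)] by blast
qed

text \<open>Dickson's lemma, with exponent vectors encoded as positive integers whose prime factors lie in \<open>P\<close>.\<close>

lemma dvd_subseq:
  fixes s :: "nat \<Rightarrow> nat"
  assumes "finite P" and s: "\<And>i. s i > 0" "\<And>i p. prime p \<Longrightarrow> p dvd s i \<Longrightarrow> p \<in> P"
  shows "\<exists>f :: nat \<Rightarrow> nat. strict_mono f \<and> (\<forall>i j. i \<le> j \<longrightarrow> s (f i) dvd s (f j))"
proof -
  obtain f where f: "strict_mono f" "\<forall>p\<in>P. incseq ((\<lambda>i. multiplicity p (s i)) \<circ> f)"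
    using finite_family_incseq_subseq[OF assms(1), of "\<lambda>p i. multiplicity p (s i)"] by blast
  have "s (f i) dvd s (f j)" if "i \<le> j" for i j
  proof (rule multiplicity_le_imp_dvd)
    show "s (f i) \<noteq> 0" using s(1)[of "f i"] by simp
    show "multiplicity p (s (f i)) \<le> multiplicity p (s (f j))" if "prime p" for p
    proof (cases "p \<in> P")
      case True
      then show ?thesis using f(2) \<open>i \<le> j\<close> by (auto simp: incseq_def)
    next
      case False
      then have "\<not> p dvd s (f i)" using s(2)[OF that] by blast
      then show ?thesis by (simp add: not_dvd_imp_multiplicity_0)
    qed
  qed
  then show ?thesis using f(1) by blast
qed

text \<open>Each generator receives its own prime, and \<open>a n\<close> is the product of the
  generators raised to the multiplicities of their primes in \<open>n\<close>. Commutativity makes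
  this multiplicative, so the image of the integers supported on \<open>P\<close> is a submonoid
  containing \<open>S\<close>.\<close>

lemma (in comm_monoid) monomial_enumeration:
  fixes S :: "'a set"
  assumes S: "finite S" "generates_monoid G S"
  obtains P :: "nat set" and a :: "nat \<Rightarrow> 'a" where "finite P"
    "a ` {n. n > 0 \<and> (\<forall>p. prime p \<longrightarrow> p dvd n \<longrightarrow> p \<in> P)} = carrier G"
    "\<forall>m>0. \<forall>n>0. a (m * n) = a m \<otimes> a n"
proof -
  have SG: "S \<subseteq> carrier G" and gen: "\<And>N. submonoid N G \<Longrightarrow> S \<subseteq> N \<Longrightarrow> N = carrier G"
    using S(2) by (auto simp: generates_monoid_def)
  obtain P :: "nat set" where P: "finite P" "card P = card S" "P \<subseteq> {p. prime p}"
    using infinite_arbitrarily_large[OF primes_infinite, of "card S"] by metis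
  obtain q where q: "bij_betw q S P" using finite_same_card_bij[OF S(1) P(1)] P(2) by metis
  have qP: "prime (q \<sigma>)" if "\<sigma> \<in> S" for \<sigma> using that q P(3) by (auto simp: bij_betw_def)
  define a :: "nat \<Rightarrow> 'a" where "a n = finprod G (\<lambda>\<sigma>. \<sigma> [^] multiplicity (q \<sigma>) n) S" for n
  have pow: "(\<lambda>\<sigma>. \<sigma> [^] multiplicity (q \<sigma>) n) \<in> S \<rightarrow> carrier G" for n using SG by auto
  have a_closed: "a n \<in> carrier G" for n unfolding a_def by (rule finprod_closed[OF pow])
  have a_mult: "a (m * n) = a m \<otimes> a n" if "m > 0" "n > 0" for m n
  proof -
    have "a (m * n) = finprod G (\<lambda>\<sigma>. \<sigma> [^] multiplicity (q \<sigma>) m \<otimes> \<sigma> [^] multiplicity (q \<sigma>) n) S"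
      unfolding a_def
    proof (rule finprod_cong')
      show "\<sigma> [^] multiplicity (q \<sigma>) (m * n) = \<sigma> [^] multiplicity (q \<sigma>) m \<otimes> \<sigma> [^] multiplicity (q \<sigma>) n"
        if "\<sigma> \<in> S" for \<sigma>
        using that SG qP[OF that] \<open>m > 0\<close> \<open>n > 0\<close>
        by (subst prime_elem_multiplicity_mult_distrib) (auto simp: nat_pow_mult)
    qed (use SG in auto)
    also have "\<dots> = a m \<otimes> a n" unfolding a_def by (rule finprod_multf[OF pow pow])
    finally show ?thesis .
  qed
  have a_one: "a 1 = \<one>" unfolding a_def by (rule finprod_one_eqI) simp
  have a_gen: "a (q \<sigma>) = \<sigma>" if \<sigma>: "\<sigma> \<in> S" for \<sigma>
  proof -
    have "a (q \<sigma>) = finprod G (\<lambda>\<rho>. if \<sigma> = \<rho> then \<rho> else \<one>) S"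
      unfolding a_def
    proof (rule finprod_cong')
      fix \<rho> assume \<rho>: "\<rho> \<in> S"
      show "\<rho> [^] multiplicity (q \<rho>) (q \<sigma>) = (if \<sigma> = \<rho> then \<rho> else \<one>)"
      proof (cases "\<sigma> = \<rho>")
        case True
        then show ?thesis using \<rho> SG qP[OF \<rho>] by auto
      next
        case False
        then have "q \<rho> \<noteq> q \<sigma>" using q \<sigma> \<rho> by (auto simp: bij_betw_def inj_on_def)
        then show ?thesis using False prime_multiplicity_other[OF qP[OF \<rho>] qP[OF \<sigma>]] by simp
      qed
    qed (use SG in auto)
    also have "\<dots> = \<sigma>" using finprod_singleton[OF \<sigma> S(1), of "\<lambda>\<rho>. \<rho>"] SG by auto
    finally show ?thesis .
  qed
  define Q where "Q = {n. n > 0 \<and> (\<forall>p. prime p \<longrightarrow> p dvd n \<longrightarrow> p \<in> P)}"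
  have "submonoid (a ` Q) G"
  proof
    show "a ` Q \<subseteq> carrier G" using a_closed by blast
    show "\<one> \<in> a ` Q"
    proof (rule image_eqI)
      show "\<one> = a 1" using a_one by simp
      show "1 \<in> Q" by (auto simp: Q_def dest: not_prime_unit)
    qed
    fix x y assume "x \<in> a ` Q" "y \<in> a ` Q"
    then obtain m n where mn: "m \<in> Q" "n \<in> Q" "x = a m" "y = a n" by auto
    have "m * n \<in> Q" using mn(1,2) by (auto simp: Q_def prime_dvd_mult_iff)
    moreover have "x \<otimes> y = a (m * n)" using mn a_mult by (auto simp: Q_def)
    ultimately show "x \<otimes> y \<in> a ` Q" by blast
  qed
  moreover have "S \<subseteq> a ` Q"
  proof
    fix \<sigma> assume \<sigma>: "\<sigma> \<in> S"
    have "q \<sigma> \<in> Q" unfolding Q_def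
      using qP[OF \<sigma>] q \<sigma> by (auto simp: prime_gt_0_nat bij_betw_def dest: primes_dvd_imp_eq)
    then show "\<sigma> \<in> a ` Q" using a_gen[OF \<sigma>] by force
  qed
  ultimately have "a ` Q = carrier G" by (rule gen)
  then show thesis using that[OF P(1), of a] a_mult unfolding Q_def by blast
qed


section \<open>Compactness\<close>

lemma finite_subset_UN_mono:
  fixes W :: "nat \<Rightarrow> 'g set"
  assumes "finite E" "E \<subseteq> (\<Union>j. W j)" "mono W"
  shows "\<exists>j\<ge>n. E \<subseteq> W j"
  using assms(1,2)
proof (induction E rule: finite_induct)
  case empty
  then show ?case by blast
next
  case (insert g E)
  then obtain i j where "i \<ge> n" "E \<subseteq> W i" "g \<in> W j" by auto
  then show ?case
    using monoD[OF assms(3), of i "max i j"] monoD[OF assms(3), of j "max i j"]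
    by (intro exI[of _ "max i j"]) auto
qed

context admissible_group_subshift_action
begin

text \<open>For \<open>v\<close> constantly one this is the kernel of the observations in
  \<open>C\<close>; for general \<open>v\<close> it is empty or a coset of that kernel.\<close>

definition solutions ::
  "((('g \<Rightarrow> 'a) \<Rightarrow> ('g \<Rightarrow> 'a)) \<times> 'g) set \<Rightarrow> ((('g \<Rightarrow> 'a) \<Rightarrow> ('g \<Rightarrow> 'a)) \<times> 'g \<Rightarrow> 'a) \<Rightarrow> ('g \<Rightarrow> 'a) set" where
  "solutions C v = {x \<in> \<Sigma>. \<forall>p\<in>C. fst p x (snd p) = v p}"

lemma solutionsD:
  assumes "x \<in> solutions C v"
  shows "x \<in> \<Sigma>" and "(\<gamma>, g) \<in> C \<Longrightarrow> \<gamma> x g = v (\<gamma>, g)"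
  using assms unfolding solutions_def by (auto dest: bspec)

lemma solutionsI:
  "x \<in> \<Sigma> \<Longrightarrow> (\<And>\<gamma> g. (\<gamma>, g) \<in> C \<Longrightarrow> \<gamma> x g = v (\<gamma>, g)) \<Longrightarrow> x \<in> solutions C v"
  by (auto simp: solutions_def)

lemma solutions_mult:
  assumes C: "C \<subseteq> \<Gamma> \<times> carrier G" and k: "k \<in> solutions C (\<lambda>_. \<one>)" and y: "y \<in> solutions C v"
  shows "(\<lambda>g\<in>carrier G. k g \<otimes> y g) \<in> solutions C v"
proof -
  have ky: "k \<in> \<Sigma>" "y \<in> \<Sigma>" using k y by (auto simp: solutions_def)
  have "\<gamma> (\<lambda>g\<in>carrier G. k g \<otimes> y g) g = v (\<gamma>, g)" if p: "(\<gamma>, g) \<in> C" for \<gamma> g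
  proof -
    have \<gamma>: "\<gamma> \<in> \<Gamma>" and g: "g \<in> carrier G" using C p by auto
    have "\<gamma> k g = \<one>" "\<gamma> y g = v (\<gamma>, g)" using solutionsD(2)[OF k p] solutionsD(2)[OF y p] by auto
    then show ?thesis using \<Gamma>_mult[OF \<gamma> ky g] \<Sigma>_value[OF \<Gamma>_maps[OF \<gamma> ky(2)] g] by simp
  qed
  then show ?thesis by (rule solutionsI[OF mult_in_\<Sigma>[OF ky]])
qed

text \<open>The chain condition applies to the traces on \<open>V\<close> of the kernels, not to
  cosets, so stability is moved over by translation. For \<open>x\<close> solving stage
  \<open>N\<close> and any \<open>y\<close> solving stage \<open>n\<close>, the quotient of
  \<open>x\<close> by \<open>y\<close> lies in the kernel at stage \<open>N\<close>. Some
  \<open>k\<close> in the kernel at stage \<open>n\<close> has the same trace, and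
  \<open>k y\<close> solves stage \<open>n\<close> while agreeing with \<open>x\<close> on
  \<open>V\<close>.\<close>

lemma solutions_window_stabilizes:
  fixes C :: "nat \<Rightarrow> ((('g \<Rightarrow> 'a) \<Rightarrow> ('g \<Rightarrow> 'a)) \<times> 'g) set"
  assumes C: "\<And>n. finite (C n)" "\<And>n. C n \<subseteq> \<Gamma> \<times> carrier G" "mono C"
    and ne: "\<And>n. solutions (C n) v \<noteq> {}" and V: "finite V" "V \<subseteq> carrier G"
  obtains N where "\<And>n x. n \<ge> N \<Longrightarrow> x \<in> solutions (C N) v \<Longrightarrow> \<exists>y\<in>solutions (C n) v. \<forall>g\<in>V. y g = x g"
proof -
  let ?id = "\<lambda>x\<in>\<Sigma>. x"
  let ?K = "\<lambda>n. solutions (C n) (\<lambda>_. \<one>)"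
  have antimono: "solutions (C n) u \<subseteq> solutions (C m) u" if "m \<le> n" for m n u
    using monoD[OF C(3) that] by (auto simp: solutions_def)
  have "\<exists>N. \<forall>n\<ge>N. (\<lambda>x. restrict (?id x) V) ` ?K n = (\<lambda>x. restrict (?id x) V) ` ?K N"
  proof (rule admissible_descending_chain[OF V(1)])
    show "(\<lambda>x. restrict (?id x) V) ` ?K n \<in> admissible_subgroups A \<H> V" for n
      unfolding solutions_def by (rule constrained_image_admissible[OF id_in_\<Gamma> V C(1,2)])
    show "(\<lambda>x. restrict (?id x) V) ` ?K (Suc n) \<subseteq> (\<lambda>x. restrict (?id x) V) ` ?K n" for n
      by (rule image_mono[OF antimono]) simp
  qed
  then obtain N where N: "\<And>n. n \<ge> N \<Longrightarrow>
      (\<lambda>x. restrict (?id x) V) ` ?K n = (\<lambda>x. restrict (?id x) V) ` ?K N" by blast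
  have "\<exists>z\<in>solutions (C n) v. \<forall>g\<in>V. z g = x g" if n: "n \<ge> N" and x: "x \<in> solutions (C N) v" for n x
  proof -
    obtain y where y: "y \<in> solutions (C n) v" using ne[of n] by blast
    have yN: "y \<in> solutions (C N) v" using antimono[OF n] y by blast
    have xy: "x \<in> \<Sigma>" "y \<in> \<Sigma>" using x y by (auto simp: solutions_def)
    obtain w where w: "w \<in> \<Sigma>" "\<forall>\<gamma>\<in>\<Gamma>. \<forall>g\<in>carrier G. \<gamma> w g = \<gamma> x g \<otimes> inv (\<gamma> y g)"
      using \<Gamma>_quotient[OF xy] .
    have "\<gamma> w g = \<one>" if p: "(\<gamma>, g) \<in> C N" for \<gamma> g
    proof -
      have \<gamma>: "\<gamma> \<in> \<Gamma>" and g: "g \<in> carrier G" using C(2) p by auto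
      have eq: "\<gamma> x g = \<gamma> y g" using solutionsD(2)[OF x p] solutionsD(2)[OF yN p] by simp
      have "\<gamma> w g = \<gamma> x g \<otimes> inv (\<gamma> y g)" using w(2) \<gamma> g by blast
      also have "\<dots> = \<one>" unfolding eq by (rule r_inv[OF \<Sigma>_value[OF \<Gamma>_maps[OF \<gamma> xy(2)] g]])
      finally show ?thesis .
    qed
    then have "w \<in> ?K N" by (rule solutionsI[OF w(1)])
    then have "restrict (?id w) V \<in> (\<lambda>x. restrict (?id x) V) ` ?K n"
      unfolding N[OF n] by (rule imageI)
    then obtain k where k: "k \<in> ?K n" "restrict (?id w) V = restrict (?id k) V" by auto
    have k\<Sigma>: "k \<in> \<Sigma>" using k(1) by (simp add: solutions_def)
    have "(\<lambda>g\<in>carrier G. k g \<otimes> y g) g = x g" if g: "g \<in> V" for g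
    proof -
      have "k g = w g" using fun_cong[OF k(2), of g] g w(1) k\<Sigma> by simp
      also have "w g = x g \<otimes> inv (y g)"
        using bspec[OF bspec[OF w(2) id_in_\<Gamma>], of g] w(1) xy V(2) g by auto
      finally show ?thesis
        using \<Sigma>_value[OF xy(1)] \<Sigma>_value[OF xy(2)] V(2) g by (auto simp: m_assoc)
    qed
    then show ?thesis using solutions_mult[OF C(2) k(1) y] by blast
  qed
  then show thesis by (rule that)
qed

text \<open>A Mittag-Leffler argument: stabilization on every window allows solutions of growing
  systems to be chosen so that they agree on growing windows. Their limit satisfies each constraint
  because a constraint reads finitely many sites.\<close>

lemma solutions_compact:
  fixes C :: "nat \<Rightarrow> ((('g \<Rightarrow> 'a) \<Rightarrow> ('g \<Rightarrow> 'a)) \<times> 'g) set"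
  assumes C: "\<And>n. finite (C n)" "\<And>n. C n \<subseteq> \<Gamma> \<times> carrier G" "mono C"
    and ne: "\<And>n. solutions (C n) v \<noteq> {}"
    and W: "\<And>j. finite (W j)" "mono W" "(\<Union>j::nat. W j) = carrier G"
  shows "\<exists>x. \<forall>n. x \<in> solutions (C n) v"
proof -
  have antimono: "solutions (C n) u \<subseteq> solutions (C m) u" if "m \<le> n" for m n u
    using monoD[OF C(3) that] by (auto simp: solutions_def)
  have WG: "W j \<subseteq> carrier G" for j using W(3) by blast
  have "\<exists>N. \<forall>n x. n \<ge> N \<longrightarrow> x \<in> solutions (C N) v \<longrightarrow>
      (\<exists>y\<in>solutions (C n) v. \<forall>g\<in>W j. y g = x g)" for j
  proof -
    obtain N where "\<And>n x. n \<ge> N \<Longrightarrow> x \<in> solutions (C N) v \<Longrightarrow>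
        \<exists>y\<in>solutions (C n) v. \<forall>g\<in>W j. y g = x g"
      by (rule solutions_window_stabilizes[of C v "W j"]) (use C ne W WG in auto)
    then show ?thesis by blast
  qed
  then obtain t where t: "\<And>j n x. n \<ge> t j \<Longrightarrow> x \<in> solutions (C (t j)) v \<Longrightarrow>
      \<exists>y\<in>solutions (C n) v. \<forall>g\<in>W j. y g = x g" by metis
  \<comment> \<open>A nondecreasing majorant of both \<open>t\<close> and the identity.\<close>
  define N where "N j = (\<Sum>i\<le>j. t i) + j" for j
  have tN: "t j \<le> N j" for j unfolding N_def by (cases j) auto
  have jN: "j \<le> N j" for j by (simp add: N_def)
  have NSuc: "N j \<le> N (Suc j)" for j by (simp add: N_def)
  \<comment> \<open>Solving stage \<open>N j\<close>, which is at least \<open>t j\<close>, is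
    enough to be extended from \<open>W j\<close> to a solution of any later stage, so the choice
    never gets stuck.\<close>
  have "\<exists>f. \<forall>j. f j \<in> solutions (C (N j)) v \<and> (\<forall>g\<in>W j. f (Suc j) g = f j g)"
  proof (rule dependent_nat_choice)
    show "\<exists>x. x \<in> solutions (C (N 0)) v" using ne by blast
    fix x j assume "x \<in> solutions (C (N j)) v"
    then have "x \<in> solutions (C (t j)) v" using antimono[OF tN] by blast
    then show "\<exists>y. y \<in> solutions (C (N (Suc j))) v \<and> (\<forall>g\<in>W j. y g = x g)"
      using t[of j "N (Suc j)" x] tN[of j] NSuc[of j] by auto
  qed
  then obtain f where f: "\<And>j. f j \<in> solutions (C (N j)) v"
    and fSuc: "\<And>j g. g \<in> W j \<Longrightarrow> f (Suc j) g = f j g" by blast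
  have f_stable: "f k g = f j g" if "j \<le> k" "g \<in> W j" for j k g
    using that(1)
  proof (induction k rule: dec_induct)
    case (step k)
    have "g \<in> W k" using monoD[OF W(2) step.hyps(1)] that(2) by blast
    then show ?case using fSuc step.IH by simp
  qed simp
  define x where "x = (\<lambda>g\<in>carrier G. f (LEAST j. g \<in> W j) g)"
  have x_eq: "x g = f j g" if g: "g \<in> W j" for g j
  proof -
    have "f j g = f (LEAST j. g \<in> W j) g"
      using f_stable[OF Least_le[of "\<lambda>j. g \<in> W j", OF g] LeastI[of "\<lambda>j. g \<in> W j", OF g]] .
    then show ?thesis using g WG by (auto simp: x_def)
  qed
  have f\<Sigma>: "f j \<in> \<Sigma>" for j using f[of j] by (simp add: solutions_def)
  have x\<Sigma>: "x \<in> \<Sigma>"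
  proof (rule in_\<Sigma>I)
    show "x \<in> carrier G \<rightarrow>\<^sub>E carrier A" unfolding x_def using \<Sigma>_value[OF f\<Sigma>] by auto
    fix E assume E: "finite E" "E \<subseteq> carrier G"
    obtain j where "E \<subseteq> W j"
      using finite_subset_UN_mono[OF E(1) _ W(2), of 0] E(2) W(3) by auto
    then show "\<exists>y\<in>\<Sigma>. \<forall>g\<in>E. y g = x g"
      using x_eq f\<Sigma> by (intro bexI[of _ "f j"]) auto
  qed
  have "\<gamma> x g = v (\<gamma>, g)" if p: "(\<gamma>, g) \<in> C n" for n \<gamma> g
  proof -
    have \<gamma>: "\<gamma> \<in> \<Gamma>" and g: "{g} \<subseteq> carrier G" using C(2) p by auto
    obtain F where F: "finite F" "F \<subseteq> carrier G"
      "\<forall>x\<in>\<Sigma>. \<forall>y\<in>\<Sigma>. (\<forall>g\<in>F. x g = y g) \<longrightarrow> (\<forall>g\<in>{g}. \<gamma> x g = \<gamma> y g)"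
      using finite_memory[OF \<gamma> finite.insertI[OF finite.emptyI] g] .
    obtain j where j: "j \<ge> n" "F \<subseteq> W j"
      \<comment> \<open>Besides containing the memory \<open>F\<close>, the index must satisfy
        \<open>j \<ge> n\<close>; then \<open>N j \<ge> n\<close>, and \<open>f j\<close> already
        satisfies the constraints in \<open>C n\<close>.\<close>
      using finite_subset_UN_mono[OF F(1) _ W(2), of n] F(2) W(3) by auto
    have "\<forall>g\<in>F. x g = f j g" using x_eq j(2) by auto
    then have "\<gamma> x g = \<gamma> (f j) g" using F(3) x\<Sigma> f\<Sigma> by blast
    moreover have "f j \<in> solutions (C n) v"
      using subsetD[OF antimono[OF le_trans[OF j(1) jN]] f] .
    ultimately show ?thesis using solutionsD(2)[OF _ p] by simp
  qed
  then have "x \<in> solutions (C n) v" for n by (rule solutionsI[OF x\<Sigma>])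
  then show ?thesis by blast
qed

end


section \<open>Shadowing\<close>

context admissible_group_subshift_action
begin

section \<open>Propagation of exactness from generators to words, and shadowing on windows\<close>

abbreviation "\<Gamma>_monoid \<equiv> (End_grp G A \<H> \<Sigma>)\<lparr>carrier := \<Gamma>\<rparr>"

lemma \<Gamma>_monoid_simps:
  "carrier \<Gamma>_monoid = \<Gamma>" "\<sigma> \<otimes>\<^bsub>\<Gamma>_monoid\<^esub> \<tau> = compose \<Sigma> \<sigma> \<tau>" "\<one>\<^bsub>\<Gamma>_monoid\<^esub> = (\<lambda>x\<in>\<Sigma>. x)"
  by (simp_all add: End_grp_def)

text \<open>A continuity estimate in exact form: vanishing one-step errors on \<open>F\<close> leave
  no error on \<open>E\<close> after all of \<open>\<gamma>\<close>, uniformly in \<open>z\<close>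
  and in the starting index \<open>\<tau>\<close>.\<close>

definition control_window ::
  "(('g \<Rightarrow> 'a) \<Rightarrow> ('g \<Rightarrow> 'a)) set \<Rightarrow> (('g \<Rightarrow> 'a) \<Rightarrow> ('g \<Rightarrow> 'a)) \<Rightarrow> 'g set \<Rightarrow> 'g set \<Rightarrow> bool" where
  "control_window S \<gamma> E F \<longleftrightarrow> finite F \<and> F \<subseteq> carrier G \<and>
    (\<forall>z. (\<forall>\<tau>\<in>\<Gamma>. z \<tau> \<in> \<Sigma>) \<longrightarrow>
      (\<forall>\<sigma>\<in>S. \<forall>\<tau>\<in>\<Gamma>. \<forall>g\<in>F. \<sigma> (z \<tau>) g = z (compose \<Sigma> \<sigma> \<tau>) g) \<longrightarrow>
      (\<forall>\<tau>\<in>\<Gamma>. \<forall>g\<in>E. \<gamma> (z \<tau>) g = z (compose \<Sigma> \<gamma> \<tau>) g))"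

text \<open>The endomorphisms that have a window for every \<open>E\<close> form a submonoid
  containing \<open>S\<close>. For a composite of \<open>\<rho>\<close> and \<open>\<sigma>\<close>,
  exactness of \<open>\<sigma>\<close> is demanded on the memory of \<open>\<rho>\<close> over
  \<open>E\<close>, and exactness of \<open>\<rho>\<close> on \<open>E\<close> itself.\<close>

lemma control_window_exists:
  assumes mon: "monoid \<Gamma>_monoid" and S: "generates_monoid \<Gamma>_monoid S"
    and \<gamma>: "\<gamma> \<in> \<Gamma>" and E: "finite E" "E \<subseteq> carrier G"
  shows "\<exists>F. control_window S \<gamma> E F"
proof -
  interpret \<Gamma>: monoid \<Gamma>_monoid by (rule mon)
  have comp_closed: "compose \<Sigma> \<sigma> \<tau> \<in> \<Gamma>" if "\<sigma> \<in> \<Gamma>" "\<tau> \<in> \<Gamma>" for \<sigma> \<tau>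
    using \<Gamma>.m_closed[of \<sigma> \<tau>] that by (simp only: \<Gamma>_monoid_simps)
  have comp_assoc: "compose \<Sigma> (compose \<Sigma> \<rho> \<sigma>) \<tau> = compose \<Sigma> \<rho> (compose \<Sigma> \<sigma> \<tau>)"
    if "\<rho> \<in> \<Gamma>" "\<sigma> \<in> \<Gamma>" "\<tau> \<in> \<Gamma>" for \<rho> \<sigma> \<tau>
    using \<Gamma>.m_assoc[of \<rho> \<sigma> \<tau>] that by (simp only: \<Gamma>_monoid_simps)
  have comp_id: "compose \<Sigma> (\<lambda>x\<in>\<Sigma>. x) \<tau> = \<tau>" if "\<tau> \<in> \<Gamma>" for \<tau>
    using \<Gamma>.l_one[of \<tau>] that by (simp only: \<Gamma>_monoid_simps)
  define N where "N = {\<gamma> \<in> \<Gamma>. \<forall>E. finite E \<longrightarrow> E \<subseteq> carrier G \<longrightarrow> (\<exists>F. control_window S \<gamma> E F)}"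
  have S\<Gamma>: "S \<subseteq> \<Gamma>" using S unfolding generates_monoid_def \<Gamma>_monoid_simps by blast
  have "submonoid N \<Gamma>_monoid"
  proof
    show "N \<subseteq> carrier \<Gamma>_monoid" by (auto simp: N_def \<Gamma>_monoid_simps)
    have "control_window S (\<lambda>x\<in>\<Sigma>. x) E {}" for E unfolding control_window_def using comp_id by auto
    then show "\<one>\<^bsub>\<Gamma>_monoid\<^esub> \<in> N" unfolding \<Gamma>_monoid_simps N_def using id_in_\<Gamma> by blast
    fix \<rho> \<sigma> assume \<rho>: "\<rho> \<in> N" and \<sigma>: "\<sigma> \<in> N"
    have \<rho>\<Gamma>: "\<rho> \<in> \<Gamma>" and \<sigma>\<Gamma>: "\<sigma> \<in> \<Gamma>" using \<rho> \<sigma> by (auto simp: N_def)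
    have "\<exists>F. control_window S (compose \<Sigma> \<rho> \<sigma>) E F" if E: "finite E" "E \<subseteq> carrier G" for E
    proof -
      obtain V where V: "finite V" "V \<subseteq> carrier G"
        and Vm: "\<forall>x\<in>\<Sigma>. \<forall>y\<in>\<Sigma>. (\<forall>g\<in>V. x g = y g) \<longrightarrow> (\<forall>g\<in>E. \<rho> x g = \<rho> y g)"
        using finite_memory[OF \<rho>\<Gamma> E] .
      obtain F\<^sub>1 where F1: "control_window S \<rho> E F\<^sub>1" using \<rho> E unfolding N_def by blast
      obtain F\<^sub>2 where F2: "control_window S \<sigma> V F\<^sub>2" using \<sigma> V unfolding N_def by blast
      have "control_window S (compose \<Sigma> \<rho> \<sigma>) E (F\<^sub>1 \<union> F\<^sub>2)"
        unfolding control_window_def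
      proof (intro conjI allI impI ballI)
        show "finite (F\<^sub>1 \<union> F\<^sub>2)" "F\<^sub>1 \<union> F\<^sub>2 \<subseteq> carrier G" using F1 F2 by (auto simp: control_window_def)
        fix z \<tau> g
        assume z: "\<forall>\<tau>\<in>\<Gamma>. z \<tau> \<in> \<Sigma>"
          and ps: "\<forall>\<sigma>\<in>S. \<forall>\<tau>\<in>\<Gamma>. \<forall>g\<in>F\<^sub>1 \<union> F\<^sub>2. \<sigma> (z \<tau>) g = z (compose \<Sigma> \<sigma> \<tau>) g"
          and \<tau>: "\<tau> \<in> \<Gamma>" and g: "g \<in> E"
        have \<sigma>\<tau>: "compose \<Sigma> \<sigma> \<tau> \<in> \<Gamma>" using comp_closed \<sigma>\<Gamma> \<tau> .
        have z\<tau>: "z \<tau> \<in> \<Sigma>" and z\<sigma>\<tau>: "z (compose \<Sigma> \<sigma> \<tau>) \<in> \<Sigma>" using z \<tau> \<sigma>\<tau> by auto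
        have "\<forall>g\<in>V. \<sigma> (z \<tau>) g = z (compose \<Sigma> \<sigma> \<tau>) g"
          using F2 z ps \<tau> unfolding control_window_def by blast
        then have "\<rho> (\<sigma> (z \<tau>)) g = \<rho> (z (compose \<Sigma> \<sigma> \<tau>)) g"
          using Vm \<Gamma>_maps[OF \<sigma>\<Gamma> z\<tau>] z\<sigma>\<tau> g by blast
        also have "\<dots> = z (compose \<Sigma> \<rho> (compose \<Sigma> \<sigma> \<tau>)) g"
          using F1 z ps \<sigma>\<tau> g unfolding control_window_def by blast
        finally show "compose \<Sigma> \<rho> \<sigma> (z \<tau>) g = z (compose \<Sigma> (compose \<Sigma> \<rho> \<sigma>) \<tau>) g"
          using comp_assoc[OF \<rho>\<Gamma> \<sigma>\<Gamma> \<tau>] z\<tau> by (simp add: compose_def)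
      qed
      then show ?thesis by blast
    qed
    then show "\<rho> \<otimes>\<^bsub>\<Gamma>_monoid\<^esub> \<sigma> \<in> N"
      unfolding \<Gamma>_monoid_simps N_def using comp_closed[OF \<rho>\<Gamma> \<sigma>\<Gamma>] by blast
  qed
  moreover have "S \<subseteq> N"
  proof
    fix \<sigma> assume \<sigma>: "\<sigma> \<in> S"
    have "control_window S \<sigma> E E" if "finite E" "E \<subseteq> carrier G" for E
      unfolding control_window_def using that \<sigma> by blast
    then show "\<sigma> \<in> N" unfolding N_def using S\<Gamma> \<sigma> by blast
  qed
  ultimately have "N = \<Gamma>" using S unfolding generates_monoid_def \<Gamma>_monoid_simps by blast
  then show ?thesis using \<gamma> E unfolding N_def by blast
qed

lemma window_shadowing:
  assumes comm: "comm_monoid \<Gamma>_monoid" and S: "finite S" "generates_monoid \<Gamma>_monoid S"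
    and E: "finite E" "E \<subseteq> carrier G"
    and W: "\<And>j. finite (W j)" "mono W" "(\<Union>j::nat. W j) = carrier G"
  obtains F where "finite F" "F \<subseteq> carrier G"
    "\<forall>z. (\<forall>\<tau>\<in>\<Gamma>. z \<tau> \<in> \<Sigma>) \<longrightarrow>
      (\<forall>\<sigma>\<in>S. \<forall>\<tau>\<in>\<Gamma>. \<forall>g\<in>F. \<sigma> (z \<tau>) g = z (compose \<Sigma> \<sigma> \<tau>) g) \<longrightarrow>
      (\<exists>y\<in>\<Sigma>. \<forall>\<tau>\<in>\<Gamma>. \<forall>g\<in>E. \<tau> y g = z \<tau> g)"
proof -
  interpret \<Gamma>: comm_monoid \<Gamma>_monoid by (rule comm)
  obtain P and a :: "nat \<Rightarrow> ('g \<Rightarrow> 'a) \<Rightarrow> ('g \<Rightarrow> 'a)" where P: "finite P"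
    and aQ: "a ` {n. n > 0 \<and> (\<forall>p. prime p \<longrightarrow> p dvd n \<longrightarrow> p \<in> P)} = carrier \<Gamma>_monoid"
    and a_mult: "\<forall>m>0. \<forall>n>0. a (m * n) = a m \<otimes>\<^bsub>\<Gamma>_monoid\<^esub> a n"
    using \<Gamma>.monomial_enumeration[OF S] .
  define Q where "Q = {n. n > 0 \<and> (\<forall>p. prime p \<longrightarrow> p dvd n \<longrightarrow> p \<in> P)}"
  have a\<Gamma>: "a ` Q = \<Gamma>" using aQ unfolding Q_def \<Gamma>_monoid_simps .
  have a_in: "a n \<in> \<Gamma>" if "n \<in> Q" for n using a\<Gamma> that by blast
  have Q_pos: "n > 0" if "n \<in> Q" for n using that by (simp add: Q_def)
  have Q_dvd: "m \<in> Q" if "m dvd n" "n \<in> Q" for m n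
    using that by (auto simp: Q_def intro: dvd_trans dvd_pos_nat)
  have a_comp: "a (m * n) = compose \<Sigma> (a m) (a n)" if "m \<in> Q" "n \<in> Q" for m n
    using a_mult Q_pos that unfolding \<Gamma>_monoid_simps by blast
  have a_app: "a (m * n) x = a m (a n x)" if "m \<in> Q" "n \<in> Q" "x \<in> \<Sigma>" for m n x
    using a_comp that by (simp add: compose_def)
  \<comment> \<open>The strict bound makes \<open>C 0\<close> empty, so the later induction may
    start at any point of \<Sigma>. Constraints are recorded by \<open>a m\<close> rather than
    \<open>m\<close>; repeated values of \<open>a\<close> cannot conflict, since \<open>z\<close> is
    indexed by \<Gamma>.\<close>
  define C where "C n = a ` {m \<in> Q. m < n} \<times> E" for n
  have C: "finite (C n)" "C n \<subseteq> \<Gamma> \<times> carrier G" "mono C" for n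
    using E a_in by (auto simp: C_def intro!: monoI)
  have CI: "(a m, g) \<in> C n" if "m \<in> Q" "m < n" "g \<in> E" for m n g
    using that by (auto simp: C_def)
  define L where "L n = (\<lambda>x. restrict (a n x) E) ` solutions (C n) (\<lambda>_. \<one>)" for n
  have L_adm: "L n \<in> admissible_subgroups A \<H> E" if "n \<in> Q" for n
    unfolding L_def solutions_def by (rule constrained_image_admissible[OF a_in[OF that] E C(1,2)])
  \<comment> \<open>With \<open>n = m * e\<close>, the point \<open>a e x\<close> witnesses
    membership in \<open>L m\<close>: for \<open>k < m\<close> one has \<open>k * e < n\<close>, so
    triviality of \<open>x\<close> below \<open>n\<close> gives triviality of \<open>a e x\<close>
    below \<open>m\<close>.\<close>
  have L_dvd: "L n \<subseteq> L m" if mn: "m dvd n" and n: "n \<in> Q" for m n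
  proof -
    obtain e where e: "n = m * e" using mn by blast
    have m: "m \<in> Q" and eQ: "e \<in> Q" using Q_dvd[OF _ n, of m] Q_dvd[OF _ n, of e] e by simp_all
    show ?thesis
    proof
      fix w assume "w \<in> L n"
      then obtain x where x: "x \<in> solutions (C n) (\<lambda>_. \<one>)" "w = restrict (a n x) E"
        by (auto simp: L_def)
      have "a e x \<in> solutions (C m) (\<lambda>_. \<one>)"
      proof (rule solutionsI)
        show "a e x \<in> \<Sigma>" using \<Gamma>_maps[OF a_in[OF eQ] solutionsD(1)[OF x(1)]] .
        fix \<gamma> g assume "(\<gamma>, g) \<in> C m"
        then obtain k where k: "k \<in> Q" "k < m" "\<gamma> = a k" "g \<in> E" by (auto simp: C_def)
        have "k * e < n" unfolding e using k(2) Q_pos[OF eQ] by simp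
        moreover have "k * e \<in> Q" using k(1) eQ by (auto simp: Q_def prime_dvd_mult_iff)
        ultimately have "a (k * e) x g = \<one>" using solutionsD(2)[OF x(1) CI] k(4) by blast
        then show "\<gamma> (a e x) g = \<one>" using a_app[OF k(1) eQ solutionsD(1)[OF x(1)]] k(3) by simp
      qed
      moreover have "w = restrict (a m (a e x)) E"
        using x(2) a_app[OF m eQ solutionsD(1)[OF x(1)]] e by simp
      ultimately show "w \<in> L m" unfolding L_def by blast
    qed
  qed
  \<comment> \<open>\<open>M\<close> is finite: an infinite subset would contain an infinite divisibility chain, along which \<open>L\<close> descends strictly.\<close>
  define M where "M = {n \<in> Q. \<forall>m. m dvd n \<longrightarrow> L m = L n \<longrightarrow> m = n}"
  have finM: "finite M"
  proof (rule ccontr)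
    assume inf: "infinite M"
    have en: "enumerate M i \<in> M" for i using enumerate_in_set[OF inf] .
    have enQ: "enumerate M i \<in> Q" for i using en[of i] by (simp add: M_def)
    have "enumerate M i > 0" "\<And>p. prime p \<Longrightarrow> p dvd enumerate M i \<Longrightarrow> p \<in> P" for i
      using enQ[of i] by (auto simp: Q_def)
    then obtain f :: "nat \<Rightarrow> nat" where f: "strict_mono f"
        "\<forall>i j. i \<le> j \<longrightarrow> enumerate M (f i) dvd enumerate M (f j)"
      using dvd_subseq[OF P, of "enumerate M"] by blast
    let ?s = "\<lambda>i. enumerate M (f i)"
    have "\<exists>N. \<forall>i\<ge>N. L (?s i) = L (?s N)"
    proof (rule admissible_descending_chain[OF E(1)])
      show "L (?s i) \<in> admissible_subgroups A \<H> E" for i using L_adm[OF enQ] .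
      show "L (?s (Suc i)) \<subseteq> L (?s i)" for i using f(2) by (intro L_dvd enQ) simp
    qed
    then obtain N where "L (?s (Suc N)) = L (?s N)" by (meson le_SucI order_refl)
    moreover have "?s N dvd ?s (Suc N)" using f(2) by simp
    ultimately have "?s N = ?s (Suc N)" using en[of "f (Suc N)"] unfolding M_def by auto
    moreover have "?s N < ?s (Suc N)"
      using f(1) inf by (intro enumerate_mono) (auto simp: strict_mono_Suc_iff)
    ultimately show False by simp
  qed
  have M_cover: "\<exists>m\<in>M. m dvd n \<and> L m = L n" if n: "n \<in> Q" for n
  proof -
    \<comment> \<open>The numerically least divisor with the same \<open>L\<close> is also minimal
      for divisibility, because a divisor of a positive integer is at most that integer.\<close>
    define m where "m = (LEAST m. m dvd n \<and> L m = L n)"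
    have m: "m dvd n" "L m = L n" using LeastI[of "\<lambda>m. m dvd n \<and> L m = L n" n] by (auto simp: m_def)
    have "k = m" if k: "k dvd m" "L k = L m" for k
    proof -
      have "m \<le> k" unfolding m_def using k m by (intro Least_le) (auto intro: dvd_trans)
      moreover have "k \<le> m" using dvd_imp_le[OF k(1)] Q_pos[OF Q_dvd[OF m(1) n]] by simp
      ultimately show ?thesis by simp
    qed
    then have "m \<in> M" unfolding M_def using Q_dvd[OF m(1) n] by blast
    then show ?thesis using m by blast
  qed
  have "\<forall>m\<in>Q. \<exists>F. control_window S (a m) E F"
    using control_window_exists[OF \<Gamma>.monoid_axioms S(2) a_in E] by blast
  then obtain Fm where Fm: "\<And>m. m \<in> Q \<Longrightarrow> control_window S (a m) E (Fm m)" by metis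
  obtain B where B: "\<And>m. m \<in> M \<Longrightarrow> m \<le> B"
    using finM unfolding finite_nat_set_iff_bounded_le by blast
  \<comment> \<open>Windows are collected for every index of \<open>Q\<close> up to
    \<open>B\<close>, not only for those in \<open>M\<close>: the correction at \<open>m\<close>
    also evaluates \<open>a k\<close> for all \<open>k < m\<close>.\<close>
  define F where "F = (\<Union>m\<in>{m \<in> Q. m \<le> B}. Fm m)"
  have F: "finite F" "F \<subseteq> carrier G" unfolding F_def using Fm by (auto simp: control_window_def)
  show thesis
  proof (rule that[OF F], intro allI impI)
    fix z :: "(('g \<Rightarrow> 'a) \<Rightarrow> ('g \<Rightarrow> 'a)) \<Rightarrow> 'g \<Rightarrow> 'a"
    assume z_all: "\<forall>\<tau>\<in>\<Gamma>. z \<tau> \<in> \<Sigma>"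
      and ps: "\<forall>\<sigma>\<in>S. \<forall>\<tau>\<in>\<Gamma>. \<forall>g\<in>F. \<sigma> (z \<tau>) g = z (compose \<Sigma> \<sigma> \<tau>) g"
    note z = bspec[OF z_all]
    define v where "v p = z (fst p) (snd p)" for p
    have small: "a k (z (a e)) g = z (a (k * e)) g" if k: "k \<in> Q" "k \<le> B" and e: "e \<in> Q" and g: "g \<in> E" for k e g
    proof -
      have "\<forall>\<sigma>\<in>S. \<forall>\<tau>\<in>\<Gamma>. \<forall>g\<in>Fm k. \<sigma> (z \<tau>) g = z (compose \<Sigma> \<sigma> \<tau>) g"
        using ps k by (auto simp: F_def)
      then have "a k (z (a e)) g = z (compose \<Sigma> (a k) (a e)) g"
        using Fm[OF k(1)] z_all a_in[OF e] g unfolding control_window_def by blast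
      then show ?thesis using a_comp[OF k(1) e] by simp
    qed
    have "solutions (C n) v \<noteq> {}" for n
    proof (induction n)
      case 0
      have "z (\<lambda>x\<in>\<Sigma>. x) \<in> solutions (C 0) v"
        using z[OF id_in_\<Gamma>] by (intro solutionsI) (auto simp: C_def)
      then show ?case by blast
    next
      case (Suc n)
      then obtain x where x: "x \<in> solutions (C n) v" by blast
      note x\<Sigma> = solutionsD(1)[OF x]
      have x_eq: "a k x g = z (a k) g" if "k \<in> Q" "k < n" "g \<in> E" for k g
        using solutionsD(2)[OF x CI[OF that]] by (simp add: v_def)
      show ?case
      proof (cases "n \<in> Q")
        case False
        then have "C (Suc n) = C n" by (auto simp: C_def less_Suc_eq)
        then show ?thesis using Suc by simp
      next
        case nQ: True
        obtain m where m: "m \<in> M" "m dvd n" "L m = L n" using M_cover[OF nQ] by blast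
        obtain e where n_eq: "n = m * e" using m(2) by blast
        have mQ: "m \<in> Q" and eQ: "e \<in> Q" using Q_dvd[OF _ nQ, of m] Q_dvd[OF _ nQ, of e] n_eq by simp_all
        have mB: "m \<le> B" using B[OF m(1)] .
        let ?ze = "z (a e)" and ?ex = "a e x"
        have ze: "?ze \<in> \<Sigma>" using z[OF a_in[OF eQ]] .
        have ex: "?ex \<in> \<Sigma>" using \<Gamma>_maps[OF a_in[OF eQ] x\<Sigma>] .
        obtain w where w: "w \<in> \<Sigma>"
          "\<forall>\<gamma>\<in>\<Gamma>. \<forall>g\<in>carrier G. \<gamma> w g = \<gamma> ?ze g \<otimes> inv (\<gamma> ?ex g)"
          using \<Gamma>_quotient[OF ze ex] .
        \<comment> \<open>Pseudo-orbit and orbit are both brought to index \<open>k * e\<close>, the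
          former by \<open>small\<close>. The cases \<open>k < m\<close> make \<open>w\<close>
          trivial below \<open>m\<close>; the case \<open>k = m\<close> gives the error at
          \<open>n\<close> that is to be corrected.\<close>
        have w_eq: "a k w g = z (a (k * e)) g \<otimes> inv (a (k * e) x g)"
          if k: "k \<in> Q" "k \<le> m" and g: "g \<in> E" for k g
        proof -
          have "a k w g = a k ?ze g \<otimes> inv (a k ?ex g)" using w(2) a_in[OF k(1)] g E(2) by blast
          then show ?thesis
            using small[OF k(1) le_trans[OF k(2) mB] eQ g] a_app[OF k(1) eQ x\<Sigma>] by simp
        qed
        have "w \<in> solutions (C m) (\<lambda>_. \<one>)"
        proof (rule solutionsI[OF w(1)])
          fix \<gamma> g assume "(\<gamma>, g) \<in> C m"
          then obtain k where k: "k \<in> Q" "k < m" "\<gamma> = a k" "g \<in> E" by (auto simp: C_def)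
          have ke: "k * e < n" unfolding n_eq using k(2) Q_pos[OF eQ] by simp
          have keQ: "k * e \<in> Q" using k(1) eQ by (auto simp: Q_def prime_dvd_mult_iff)
          have eq: "a (k * e) x g = z (a (k * e)) g" using x_eq[OF keQ ke k(4)] .
          have "z (a (k * e)) g \<in> carrier A"
            using \<Sigma>_value[OF z[OF a_in[OF keQ]]] k(4) E(2) by blast
          then show "\<gamma> w g = \<one>" using w_eq[OF k(1) less_imp_le[OF k(2)] k(4)] eq k(3) by simp
        qed
        then have "restrict (a m w) E \<in> L m" unfolding L_def by (rule imageI)
        then have "restrict (a m w) E \<in> L n" unfolding m(3) .
        then obtain u where u: "u \<in> solutions (C n) (\<lambda>_. \<one>)" "restrict (a m w) E = restrict (a n u) E"
          by (auto simp: L_def)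
        \<comment> \<open>At \<open>n\<close> the factor \<open>u\<close> contributes
          \<open>z (a n) g\<close> times the inverse of \<open>a n x g\<close>, so it must stand on
          the left for \<open>a n x g\<close> to cancel; below \<open>n\<close> it is trivial and
          leaves \<open>x\<close> unchanged.\<close>
        let ?y = "\<lambda>g\<in>carrier G. u g \<otimes> x g"
        have "?y \<in> solutions (C (Suc n)) v"
        proof (rule solutionsI)
          have y: "?y \<in> solutions (C n) v" by (rule solutions_mult[OF C(2) u(1) x])
          then show "?y \<in> \<Sigma>" by (rule solutionsD)
          fix \<gamma> g assume "(\<gamma>, g) \<in> C (Suc n)"
          then obtain k where k: "k \<in> Q" "k < Suc n" "\<gamma> = a k" and g: "g \<in> E" by (auto simp: C_def)
          show "\<gamma> ?y g = v (\<gamma>, g)"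
          proof (cases "k = n")
            case False
            then have "k < n" using k(2) by simp
            then show ?thesis unfolding k(3) by (intro solutionsD(2)[OF y CI[OF k(1) _ g]])
          next
            case True
            have gG: "g \<in> carrier G" using g E(2) by blast
            have c: "z (a n) g \<in> carrier A" "a n x g \<in> carrier A"
              using \<Sigma>_value[OF z[OF a_in[OF nQ]] gG] \<Sigma>_value[OF \<Gamma>_maps[OF a_in[OF nQ] x\<Sigma>] gG] by auto
            have "a n u g = a m w g" using fun_cong[OF u(2), of g] g by simp
            also have "\<dots> = z (a n) g \<otimes> inv (a n x g)" using w_eq[OF mQ order_refl g] n_eq by simp
            finally have "a n u g \<otimes> a n x g = z (a n) g" using c by (simp add: m_assoc)
            then show ?thesis
              unfolding k(3) True v_def using \<Gamma>_mult[OF a_in[OF nQ] solutionsD(1)[OF u(1)] x\<Sigma> gG] by simp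
          qed
        qed
        then show ?thesis by blast
      qed
    qed
    then obtain y where y: "\<And>n. y \<in> solutions (C n) v"
      using solutions_compact[OF C _ W, of v] by blast
    have "\<tau> y g = z \<tau> g" if \<tau>: "\<tau> \<in> \<Gamma>" and g: "g \<in> E" for \<tau> g
    proof -
      obtain m where m: "m \<in> Q" "\<tau> = a m" using a\<Gamma> \<tau> by blast
      then show ?thesis using solutionsD(2)[OF y CI[OF m(1) lessI g]] by (simp add: v_def)
    qed
    then show "\<exists>y\<in>\<Sigma>. \<forall>\<tau>\<in>\<Gamma>. \<forall>g\<in>E. \<tau> y g = z \<tau> g" using solutionsD(1)[OF y[of 0]] by blast
  qed
qed

end

section \<open>Hamming distances and agreement on windows\<close>

lemma standard_hamming_dist_le:
  assumes "restrict x (E k) = restrict y (E k)"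
  shows "standard_hamming_dist E x y \<le> (1 / 2) ^ k"
proof -
  have le: "enat k \<le> (SUP k \<in> {k. restrict x (E k) = restrict y (E k)}. enat k)"
    using assms by (intro SUP_upper) simp
  show ?thesis
  proof (cases "SUP k \<in> {k. restrict x (E k) = restrict y (E k)}. enat k")
    case (enat n)
    then show ?thesis using le by (simp add: standard_hamming_dist_def power_decreasing)
  next
    case infinity
    then show ?thesis by (simp add: standard_hamming_dist_def)
  qed
qed

text \<open>A supremum above \<open>j\<close> only yields agreement on \<open>E k\<close> for some
  \<open>k > j\<close>; monotonicity of \<open>E\<close> carries it down to
  \<open>E j\<close>.\<close>

lemma standard_hamming_dist_less_imp_eq:
  assumes "mono E" and less: "standard_hamming_dist E x y < (1 / 2) ^ j"
  shows "restrict x (E j) = restrict y (E j)"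
proof -
  have "enat j < (SUP k \<in> {k. restrict x (E k) = restrict y (E k)}. enat k)"
  proof (cases "SUP k \<in> {k. restrict x (E k) = restrict y (E k)}. enat k")
    case (enat n)
    then have "(1 / 2 :: real) ^ n < (1 / 2) ^ j" using less by (simp add: standard_hamming_dist_def)
    then have "j < n" by (simp add: power_strict_decreasing_iff)
    then show ?thesis using enat by simp
  next
    case infinity
    then show ?thesis by simp
  qed
  then obtain k where k: "restrict x (E k) = restrict y (E k)" "j < k"
    by (auto simp: less_SUP_iff)
  have "E j \<subseteq> E k" using monoD[OF assms(1)] k(2) by simp
  then have "restrict x (E j) = restrict (restrict x (E k)) (E j)"
    "restrict y (E j) = restrict (restrict y (E k)) (E j)"
    by (auto simp: fun_eq_iff restrict_def)
  then show ?thesis using k(1) by simp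
qed

theorem theorem8p1:
  fixes G :: "('g, 'b) monoid_scheme"
    and A :: "('a, 'c) monoid_scheme"
    and \<H> :: "nat \<Rightarrow> (nat \<Rightarrow> 'a) set set"
    and \<Sigma> :: "('g \<Rightarrow> 'a) set"
    and \<Gamma> :: "(('g \<Rightarrow> 'a) \<Rightarrow> ('g \<Rightarrow> 'a)) set"
  assumes "monoid G" and "countable (carrier G)"
    and "admissible_artinian_group_structure A \<H>"
    and "admissible_group_subshift G A \<H> \<Sigma>"
    and "submonoid \<Gamma> (End_grp G A \<H> \<Sigma>)"
    and "comm_monoid ((End_grp G A \<H> \<Sigma>)\<lparr>carrier := \<Gamma>\<rparr>)"
    and "finitely_generated_monoid ((End_grp G A \<H> \<Sigma>)\<lparr>carrier := \<Gamma>\<rparr>)"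
  shows "has_shadowing_property G ((End_grp G A \<H> \<Sigma>)\<lparr>carrier := \<Gamma>\<rparr>) \<Sigma> valuation_action"
proof -
  interpret A: admissible_artinian_group_structure A \<H> by (rule assms(3))
  \<comment> \<open>The unit of \<open>End_grp\<close> is the identity of \<Sigma>, so being a
    submonoid provides the locale's assumption on the identity.\<close>
  interpret admissible_group_subshift_action A \<H> G \<Sigma> \<Gamma>
    unfolding admissible_group_subshift_action_def admissible_group_subshift_action_axioms_def
    using assms(1,3,4) submonoid.subset[OF assms(5)] submonoid.one_closed[OF assms(5)]
    by (simp add: End_grp_def)
  show ?thesis unfolding has_shadowing_property_def shadowing_wrt_def
  proof (intro allI impI)
    fix S and d :: "('g \<Rightarrow> 'a) \<Rightarrow> ('g \<Rightarrow> 'a) \<Rightarrow> real" and \<epsilon> :: real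
    assume "finite S \<and> generates_monoid \<Gamma>_monoid S \<and> standard_hamming_metric G d" and \<epsilon>: "\<epsilon> > 0"
    then have S: "finite S" "generates_monoid \<Gamma>_monoid S" and d: "standard_hamming_metric G d" by auto
    obtain W where W: "\<And>n. finite (W n)" "\<And>n. W n \<subseteq> W (Suc n)" "(\<Union>n. W n) = carrier G"
      and d_eq: "d = standard_hamming_dist W"
      using d unfolding standard_hamming_metric_def by blast
    have mono_W: "mono W" using W(2) by (rule mono_iff_le_Suc[THEN iffD2, rule_format])
    \<comment> \<open>Agreement on \<open>W k\<close> keeps the distance at most
      \<open>(1 / 2) ^ k\<close>, so \<open>W k\<close> is the window that stands for
      \<epsilon>.\<close>
    obtain k where k: "(1 / 2) ^ k < \<epsilon>" using real_arch_pow_inv[OF \<epsilon>, of "1 / 2"] by auto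
    have WG: "W k \<subseteq> carrier G" using W(3) by blast
    obtain F where F: "finite F" "F \<subseteq> carrier G"
      and shadow: "\<forall>z. (\<forall>\<tau>\<in>\<Gamma>. z \<tau> \<in> \<Sigma>) \<longrightarrow>
      (\<forall>\<sigma>\<in>S. \<forall>\<tau>\<in>\<Gamma>. \<forall>g\<in>F. \<sigma> (z \<tau>) g = z (compose \<Sigma> \<sigma> \<tau>) g) \<longrightarrow>
      (\<exists>y\<in>\<Sigma>. \<forall>\<tau>\<in>\<Gamma>. \<forall>g\<in>W k. \<tau> y g = z \<tau> g)"
      using window_shadowing[OF assms(6) S W(1) WG W(1) mono_W W(3)] .
    \<comment> \<open>This fixes \<delta> as \<open>(1 / 2) ^ j\<close>: any smaller distance forces
      agreement on \<open>W j\<close>, hence on \<open>F\<close>.\<close>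
    obtain j where j: "F \<subseteq> W j"
      using finite_subset_UN_mono[OF F(1) _ mono_W, of 0] F(2) W(3) by auto
    show "\<exists>\<delta>>0. \<forall>x. pseudo_orbit \<Gamma>_monoid \<Sigma> valuation_action S d \<delta> x \<longrightarrow>
        (\<exists>y\<in>\<Sigma>. \<forall>\<tau>\<in>carrier \<Gamma>_monoid. d (valuation_action \<tau> y) (x \<tau>) < \<epsilon>)"
    proof (intro exI conjI allI impI)
      show "(0::real) < (1 / 2) ^ j" by simp
      fix z assume "pseudo_orbit \<Gamma>_monoid \<Sigma> valuation_action S d ((1 / 2) ^ j) z"
      then have z: "\<forall>\<tau>\<in>\<Gamma>. z \<tau> \<in> \<Sigma>"
        and ps: "\<And>\<sigma> \<tau>. \<sigma> \<in> S \<Longrightarrow> \<tau> \<in> \<Gamma> \<Longrightarrow> d (\<sigma> (z \<tau>)) (z (compose \<Sigma> \<sigma> \<tau>)) < (1 / 2) ^ j"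
        unfolding pseudo_orbit_def \<Gamma>_monoid_simps valuation_action_def by auto
      have "\<sigma> (z \<tau>) g = z (compose \<Sigma> \<sigma> \<tau>) g" if "\<sigma> \<in> S" "\<tau> \<in> \<Gamma>" "g \<in> F" for \<sigma> \<tau> g
      proof -
        have "restrict (\<sigma> (z \<tau>)) (W j) = restrict (z (compose \<Sigma> \<sigma> \<tau>)) (W j)"
          using standard_hamming_dist_less_imp_eq[OF mono_W] ps[OF that(1,2)] d_eq by blast
        from fun_cong[OF this, of g] show ?thesis using that(3) j by auto
      qed
      with shadow z obtain y where y: "y \<in> \<Sigma>" "\<forall>\<tau>\<in>\<Gamma>. \<forall>g\<in>W k. \<tau> y g = z \<tau> g" by blast
      have "d (\<tau> y) (z \<tau>) < \<epsilon>" if "\<tau> \<in> \<Gamma>" for \<tau>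
      proof -
        have "restrict (\<tau> y) (W k) = restrict (z \<tau>) (W k)"
          using y(2) that by (intro restrict_ext) blast
        then have "standard_hamming_dist W (\<tau> y) (z \<tau>) \<le> (1 / 2) ^ k"
          by (rule standard_hamming_dist_le)
        then show ?thesis using k unfolding d_eq by linarith
      qed
      then show "\<exists>y\<in>\<Sigma>. \<forall>\<tau>\<in>carrier \<Gamma>_monoid. d (valuation_action \<tau> y) (z \<tau>) < \<epsilon>"
        unfolding \<Gamma>_monoid_simps valuation_action_def using y(1) by blast
    qed
  qed
qed

end
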